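(* For any finite flag complex $C$, there is a balanced complex $C'$ with the same face vector as $C$.
   Context: A (finite) simplicial complex $\Delta$ on a finite vertex set $V$ is a collection of subsets of $V$ such that $\{v\}\in\Delta$ for every $v\in V$ and, whenever $B\in\Delta$ and $A\subset B$, then $A\in\Delta$; its elements are faces. The dimension of a face $F$ is $|F|-1$, and $\dim\Delta$ is the maximum dimension of its faces. A non-face is a subset $A\subseteq V$ with $A\notin\Delta$; it is minimal if all its proper subsets are faces. $\Delta$ is a flag complex if all of its minimal non-faces have exactly two elements. The chromatic number of a simplicial complex is the chromatic number of its 1-skeleton (the graph on $V$ whose edges are the 2-element faces). A simplicial complex of dimension $d-1$ is balanced if its chromatic number is $d$. For a complex $C$ of dimension $d-1$, $c_i(C)$ denotes the number of faces of $C$ with exactly $i$ vertices (so $c_0(C)=1$, counting the empty face), and the face vector of $C$ is $(c_0(C),c_1(C),\dots,c_d(C))$. *)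

theory Defs
  imports Main
begin

text \<open>
  A finite simplicial complex is given by its vertex set \<open>V\<close> and its set of faces \<open>C\<close>.
  The empty set is always a face, so the complex without any faces is excluded, while
  \<open>{{}}\<close> with \<open>V = {}\<close> is allowed.
\<close>

definition simplicial_complex :: "'a set \<Rightarrow> 'a set set \<Rightarrow> bool" where
  "simplicial_complex V C \<longleftrightarrow>
     finite V \<and> C \<subseteq> Pow V \<and> {} \<in> C \<and>
     (\<forall>v\<in>V. {v} \<in> C) \<and> (\<forall>B\<in>C. \<forall>A. A \<subseteq> B \<longrightarrow> A \<in> C)"

definition face_dim :: "'a set \<Rightarrow> int" where
  "face_dim F = int (card F) - 1"

definition complex_dim :: "'a set set \<Rightarrow> int" where
  "complex_dim C = Max (face_dim ` C)"

definition minimal_nonface :: "'a set \<Rightarrow> 'a set set \<Rightarrow> 'a set \<Rightarrow> bool" where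
  "minimal_nonface V C A \<longleftrightarrow> A \<subseteq> V \<and> A \<notin> C \<and> (\<forall>B. B \<subset> A \<longrightarrow> B \<in> C)"

definition flag_complex :: "'a set \<Rightarrow> 'a set set \<Rightarrow> bool" where
  "flag_complex V C \<longleftrightarrow>
     simplicial_complex V C \<and> (\<forall>A. minimal_nonface V C A \<longrightarrow> card A = 2)"

definition skeleton_edges :: "'a set set \<Rightarrow> 'a set set" where
  "skeleton_edges C = {F \<in> C. card F = 2}"

text \<open>Graphs are given by a vertex set and a set of two-element edges.\<close>

definition graph_colouring :: "'a set \<Rightarrow> 'a set set \<Rightarrow> nat \<Rightarrow> ('a \<Rightarrow> nat) \<Rightarrow> bool" where
  "graph_colouring V E k f \<longleftrightarrow>
     f ` V \<subseteq> {..<k} \<and> (\<forall>u v. {u, v} \<in> E \<longrightarrow> f u \<noteq> f v)"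

definition graph_chromatic_number :: "'a set \<Rightarrow> 'a set set \<Rightarrow> nat" where
  "graph_chromatic_number V E = (LEAST k. \<exists>f. graph_colouring V E k f)"

definition chromatic_number :: "'a set \<Rightarrow> 'a set set \<Rightarrow> nat" where
  "chromatic_number V C = graph_chromatic_number V (skeleton_edges C)"

definition balanced_complex :: "'a set \<Rightarrow> 'a set set \<Rightarrow> bool" where
  "balanced_complex V C \<longleftrightarrow>
     simplicial_complex V C \<and> int (chromatic_number V C) = complex_dim C + 1"

definition face_count :: "'a set set \<Rightarrow> nat \<Rightarrow> nat" where
  "face_count C i = card {F \<in> C. card F = i}"

text \<open>
  For a complex of dimension \<open>d - 1\<close> this is the list \<open>[c\<^sub>0, \<dots>, c\<^sub>d]\<close> of length \<open>d + 1\<close>;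
  equality of face vectors therefore includes equality of dimensions.
\<close>

definition face_vector :: "'a set set \<Rightarrow> nat list" where
  "face_vector C = map (face_count C) [0..<Suc (nat (complex_dim C + 1))]"

end

theory Submission
  imports Defs "HOL-Library.Nat_Bijection"
begin

text \<open>
  Faces of \<open>C\<close> are the cliques of its graph. Target vertices are natural numbers coloured by
  their residue modulo \<open>r\<close>, and \<open>C'\<close> consists, in each size \<open>k\<close>, of the first \<open>c\<^sub>k(C)\<close> sets with
  pairwise distinct colours in the colexicographic order. This is a complex as soon as the shadow
  of the first \<open>c\<^sub>k\<^sub>+\<^sub>1(C)\<close> sets has at most \<open>c\<^sub>k(C)\<close> elements.

  By the coloured Kruskal--Katona theorem of Frankl, Fueredi and Kalai, initial segments have minimal
  shadow among coloured families of the same size, so it suffices to find some coloured family of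
  \<open>c\<^sub>k\<^sub>+\<^sub>1(C)\<close> sets with a shadow of at most \<open>c\<^sub>k(C)\<close> sets. Following Frohmader, take a vertex \<open>v\<close> in as
  many \<open>(k+1)\<close>-cliques as possible, and delete the non-neighbours of \<open>v\<close> (including \<open>v\<close>) one by
  one until only the link of \<open>v\<close> remains. By induction on the number of colours this link and
  the links of the deleted vertices are replaced by initial segments in one colour less; the
  deleted vertices become vertices of the remaining colour. The choice of \<open>v\<close> makes these initial
  segments nest in the one for the link of \<open>v\<close>.
\<close>

subsection \<open>Colexicographic order and shadows\<close>

text \<open>The colexicographic order is the order of the binary encodings.\<close>

lemma set_encode_less:
  assumes "finite S" "finite T" "x \<in> T" "x \<notin> S" and above: "\<And>y. y \<in> S \<Longrightarrow> x < y \<Longrightarrow> y \<in> T"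
  shows "set_encode S < set_encode T"
proof -
  let ?U = "{y \<in> T. x < y}"
  have "set_encode S \<le> set_encode (?U \<union> {..<x})"
    unfolding set_encode_def using assms by (intro sum_mono2) (auto simp: not_less_iff_gr_or_eq)
  also have "\<dots> = set_encode ?U + sum ((^) 2) {..<x}"
    unfolding set_encode_def using assms by (intro sum.union_disjoint) auto
  also have "\<dots> < set_encode ?U + 2 ^ x"
    by (simp add: sum_power2 lessThan_atLeast0)
  also have "\<dots> = set_encode (insert x ?U)"
    unfolding set_encode_def using assms by (subst sum.insert) auto
  also have "\<dots> \<le> set_encode T"
    unfolding set_encode_def using assms by (intro sum_mono2) auto
  finally show ?thesis .
qed

text \<open>The largest element of the symmetric difference decides the order; if it lay in
  \<open>S - T\<close>, then \<open>set_encode_less\<close> would give the opposite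
  inequality.\<close>

lemma set_encode_lessE:
  assumes "finite S" "finite T" "set_encode S < set_encode T"
  obtains x where "x \<in> T" "x \<notin> S" "\<And>y. x < y \<Longrightarrow> y \<in> S \<longleftrightarrow> y \<in> T"
proof -
  let ?D = "(S - T) \<union> (T - S)"
  define x where "x = Max ?D"
  have "?D \<noteq> {}" "finite ?D" using assms by auto
  then have x: "x \<in> ?D" and mx: "\<And>y. y \<in> ?D \<Longrightarrow> y \<le> x" unfolding x_def by (auto simp del: Un_iff)
  have eq: "y \<in> S \<longleftrightarrow> y \<in> T" if "x < y" for y using mx[of y] that by auto
  have "x \<notin> S - T"
    using set_encode_less[of T S x] assms eq by auto
  with x eq that show thesis by blast
qed

lemma set_encode_mono:
  assumes "finite T" "S \<subseteq> T" shows "set_encode S \<le> set_encode T"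
  unfolding set_encode_def using assms by (intro sum_mono2) auto

lemma set_encode_replace:
  assumes "finite S" "v \<in> S" "w \<notin> S" "w < v"
  shows "set_encode (insert w (S - {v})) < set_encode S"
  by (rule set_encode_less[of _ _ v]) (use assms in auto)

lemma set_encode_replace':
  assumes "finite S" "v \<in> S" "w \<notin> S" "v < w"
  shows "set_encode S < set_encode (insert w (S - {v}))"
  by (rule set_encode_less[of _ _ w]) (use assms in auto)

lemma set_encode_insert_less_iff:
  assumes "finite S" "finite T" "x \<notin> S" "x \<notin> T"
  shows "set_encode (insert x S) < set_encode (insert x T) \<longleftrightarrow> set_encode S < set_encode T"
  using assms by simp

text \<open>The largest value \<open>M\<close> on \<open>A\<close> separates the sums: the first is
  at most \<open>card A * M\<close>, while every term of the second is at least
  \<open>Suc M\<close>. This makes the potential drop when sets are exchanged for earlier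
  ones.\<close>

lemma sum_less_of_separated:
  fixes f :: "'a \<Rightarrow> nat"
  assumes "finite A" "finite B" "card A = card B" "A \<noteq> {}"
    and less: "\<And>a b. a \<in> A \<Longrightarrow> b \<in> B \<Longrightarrow> f a < f b"
  shows "sum f A < sum f B"
proof -
  define M where "M = Max (f ` A)"
  have M: "f a \<le> M" if "a \<in> A" for a unfolding M_def using assms that by auto
  have "M \<in> f ` A" unfolding M_def using assms by (intro Max_in) auto
  then have B: "Suc M \<le> f b" if "b \<in> B" for b using less that by (auto simp: Suc_le_eq)
  have "sum f A \<le> card A * M" using sum_bounded_above[of A f M] M by simp
  also have "\<dots> < card B * Suc M" using assms by (auto simp: card_gt_0_iff)
  also have "\<dots> \<le> sum f B" using sum_bounded_below[of B "Suc M" f] B by simp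
  finally show ?thesis .
qed

section \<open>Shadows and vertex decompositions of set families\<close>

definition shadow :: "'a set set \<Rightarrow> 'a set set" where
  "shadow F = (\<Union>S\<in>F. (\<lambda>v. S - {v}) ` S)"

lemma shadowI: "S \<in> F \<Longrightarrow> v \<in> S \<Longrightarrow> S - {v} \<in> shadow F"
  by (auto simp: shadow_def)

lemma shadowE:
  assumes "X \<in> shadow F" obtains S v where "S \<in> F" "v \<in> S" "X = S - {v}"
  using assms by (auto simp: shadow_def)

lemma insert_in_shadow: "insert v X \<in> F \<Longrightarrow> v \<notin> X \<Longrightarrow> X \<in> shadow F"
  using shadowI[of "insert v X" F v] by simp

lemma finite_shadow: "finite F \<Longrightarrow> (\<And>S. S \<in> F \<Longrightarrow> finite S) \<Longrightarrow> finite (shadow F)"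
  by (auto simp: shadow_def)

text \<open>The decomposition of a family along a set \<open>W\<close> of vertices: \<open>B\<close>
  is its deletion and \<open>L w\<close> the link of \<open>w\<close>. In the uses all of
  \<open>W\<close> has one colour, so no rainbow set contains two of its vertices.\<close>

definition join :: "'a set \<Rightarrow> 'a set set \<Rightarrow> ('a \<Rightarrow> 'a set set) \<Rightarrow> 'a set set" where
  "join W B L = B \<union> (\<Union>w\<in>W. insert w ` L w)"

text \<open>Members coming from \<open>L w\<close> meet \<open>W\<close> in \<open>w\<close> alone,
  so the pieces are disjoint. The weight \<open>f\<close> is general to cover both cardinalities and
  sums of encodings.\<close>

lemma sum_join:
  fixes f :: "'a set \<Rightarrow> nat"
  assumes "finite W" "finite B" "\<And>w. w \<in> W \<Longrightarrow> finite (L w)"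
    and "\<And>S. S \<in> B \<Longrightarrow> S \<inter> W = {}" and L: "\<And>w S. w \<in> W \<Longrightarrow> S \<in> L w \<Longrightarrow> S \<inter> W = {}"
  shows "sum f (join W B L) = sum f B + (\<Sum>w\<in>W. \<Sum>S\<in>L w. f (insert w S))"
proof -
  have inj: "inj_on (insert w) (L w)" if "w \<in> W" for w
    using L[OF that] that by (intro inj_onI) (metis disjoint_iff insert_ident)
  have "sum f (join W B L) = sum f B + sum f (\<Union>w\<in>W. insert w ` L w)"
    unfolding join_def using assms by (intro sum.union_disjoint) auto
  also have "sum f (\<Union>w\<in>W. insert w ` L w) = (\<Sum>w\<in>W. sum f (insert w ` L w))"
  proof (rule sum.UNION_disjoint)
    show "\<forall>w\<in>W. \<forall>w'\<in>W. w \<noteq> w' \<longrightarrow> insert w ` L w \<inter> insert w' ` L w' = {}"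
      using L by blast
  qed (use assms in auto)
  also have "\<dots> = (\<Sum>w\<in>W. \<Sum>S\<in>L w. f (insert w S))"
    using inj by (intro sum.cong[OF refl]) (simp add: sum.reindex)
  finally show ?thesis .
qed

lemma card_join:
  assumes "finite W" "finite B" "\<And>w. w \<in> W \<Longrightarrow> finite (L w)"
    and "\<And>S. S \<in> B \<Longrightarrow> S \<inter> W = {}" and "\<And>w S. w \<in> W \<Longrightarrow> S \<in> L w \<Longrightarrow> S \<inter> W = {}"
  shows "card (join W B L) = card B + (\<Sum>w\<in>W. card (L w))"
  unfolding card_eq_sum by (rule sum_join[OF assms])

text \<open>Removing the cone vertex \<open>w\<close> exposes all of \<open>L w\<close>, and
  removing any other vertex takes place inside \<open>L w\<close>; so the shadow decomposes along
  the same \<open>W\<close>.\<close>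

lemma shadow_join:
  assumes L: "\<And>w S. w \<in> W \<Longrightarrow> S \<in> L w \<Longrightarrow> S \<inter> W = {}"
  shows "shadow (join W B L) = join W (shadow B \<union> (\<Union>w\<in>W. L w)) (\<lambda>w. shadow (L w))"
proof (intro set_eqI iffI)
  fix X assume "X \<in> shadow (join W B L)"
  then obtain S v where S: "S \<in> join W B L" "v \<in> S" "X = S - {v}" by (rule shadowE)
  then consider "S \<in> B" | w R where "w \<in> W" "R \<in> L w" "S = insert w R" by (auto simp: join_def)
  then show "X \<in> join W (shadow B \<union> (\<Union>w\<in>W. L w)) (\<lambda>w. shadow (L w))"
  proof cases
    case 1
    with S show ?thesis by (auto simp: join_def intro: shadowI)
  next
    case 2
    then have "w \<notin> R" using L by blast
    show ?thesis
    proof (cases "v = w")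
      case True
      with 2 S \<open>w \<notin> R\<close> show ?thesis by (auto simp: join_def)
    next
      case False
      then have "X = insert w (R - {v})" "R - {v} \<in> shadow (L w)"
        using 2 S by (auto intro: shadowI)
      with 2 show ?thesis by (auto simp: join_def)
    qed
  qed
next
  fix X assume "X \<in> join W (shadow B \<union> (\<Union>w\<in>W. L w)) (\<lambda>w. shadow (L w))"
  then consider "X \<in> shadow B" | w where "w \<in> W" "X \<in> L w"
    | w R where "w \<in> W" "R \<in> shadow (L w)" "X = insert w R" by (auto simp: join_def)
  then show "X \<in> shadow (join W B L)"
  proof cases
    case 1
    then show ?thesis by (auto simp: join_def shadow_def)
  next
    case 2
    then show ?thesis using L[OF 2] by (intro insert_in_shadow[of w]) (auto simp: join_def)
  next
    case 3
    then obtain S v where S: "S \<in> L w" "v \<in> S" "R = S - {v}" by (auto elim: shadowE)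
    then have "v \<noteq> w" using L[of w S] 3 by auto
    then have "X = insert w S - {v}" using S 3 by auto
    then show ?thesis using S 3 by (auto simp: join_def intro!: shadowI)
  qed
qed

lemma card_shadow_join:
  assumes "finite W" "finite B" "\<And>w. w \<in> W \<Longrightarrow> finite (L w)"
    and "\<And>S. S \<in> B \<Longrightarrow> finite S" "\<And>w S. w \<in> W \<Longrightarrow> S \<in> L w \<Longrightarrow> finite S"
    and B: "\<And>S. S \<in> B \<Longrightarrow> S \<inter> W = {}" and L: "\<And>w S. w \<in> W \<Longrightarrow> S \<in> L w \<Longrightarrow> S \<inter> W = {}"
  shows "card (shadow (join W B L)) =
    card (shadow B \<union> (\<Union>w\<in>W. L w)) + (\<Sum>w\<in>W. card (shadow (L w)))"
proof -
  have *: "S \<inter> W = {}" if "S \<in> shadow F" "\<And>S. S \<in> F \<Longrightarrow> S \<inter> W = {}" for S F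
    using that by (auto elim!: shadowE)
  have "shadow (join W B L) = join W (shadow B \<union> (\<Union>w\<in>W. L w)) (\<lambda>w. shadow (L w))"
    by (rule shadow_join) (rule L)
  moreover have "card \<dots> = card (shadow B \<union> (\<Union>w\<in>W. L w)) + (\<Sum>w\<in>W. card (shadow (L w)))"
  proof (rule card_join)
    show "S \<inter> W = {}" if "S \<in> shadow B \<union> (\<Union>w\<in>W. L w)" for S
      using that *[of S B] B L by blast
    show "S \<inter> W = {}" if "w \<in> W" "S \<in> shadow (L w)" for w S
      using that *[of S "L w"] L by blast
  qed (use assms in \<open>auto intro!: finite_shadow\<close>)
  ultimately show ?thesis by simp
qed

subsection \<open>Rainbow sets and their initial segments\<close>

text \<open>For \<open>K \<subseteq> {..<r}\<close> these are the \<open>k\<close>-vertex faces of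
  the complete multipartite complex with the residue classes in \<open>K\<close> as infinite colour
  classes. A vertex \<open>n\<close> has level \<open>n div r\<close>, and vertices are ordered by
  level first, then by colour.\<close>

definition rainbow :: "nat \<Rightarrow> nat set \<Rightarrow> nat \<Rightarrow> nat set set" where
  "rainbow r K k = {S. finite S \<and> card S = k \<and> inj_on (\<lambda>n. n mod r) S \<and> (\<lambda>n. n mod r) ` S \<subseteq> K}"

lemma rainbowD:
  assumes "S \<in> rainbow r K k"
  shows "finite S" "card S = k" "inj_on (\<lambda>n. n mod r) S" "\<And>x. x \<in> S \<Longrightarrow> x mod r \<in> K"
    and "\<And>x y. x \<in> S \<Longrightarrow> y \<in> S \<Longrightarrow> x mod r = y mod r \<Longrightarrow> x = y"
  using assms by (auto simp: rainbow_def inj_on_def)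

lemma card_colours: "S \<in> rainbow r K k \<Longrightarrow> card ((\<lambda>n. n mod r) ` S) = k"
  by (auto simp: rainbow_def card_image)

lemma rainbow_0: "rainbow r K 0 = {{}}"
  by (auto simp: rainbow_def)

lemma rainbow_insert:
  assumes "S \<in> rainbow r K k" "x mod r \<in> K" "x mod r \<notin> (\<lambda>n. n mod r) ` S"
  shows "insert x S \<in> rainbow r K (Suc k)"
proof -
  have "x \<notin> S" using assms(3) by blast
  then show ?thesis using assms by (auto simp: rainbow_def)
qed

lemma rainbow_remove:
  "S \<in> rainbow r K (Suc k) \<Longrightarrow> x \<in> S \<Longrightarrow> S - {x} \<in> rainbow r K k"
  by (auto simp: rainbow_def intro: inj_on_subset)

lemma rainbow_replace:
  assumes S: "S \<in> rainbow r K k" and v: "v \<in> S" and "x mod r \<in> K"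
    and "x mod r \<notin> (\<lambda>n. n mod r) ` (S - {v})"
  shows "insert x (S - {v}) \<in> rainbow r K k"
proof -
  have "k \<noteq> 0" using S v by (cases "k = 0") (auto simp: rainbow_0)
  then obtain j where "k = Suc j" by (cases k) auto
  then show ?thesis using assms by (auto intro!: rainbow_insert rainbow_remove)
qed

lemma rainbow_replace_same:
  assumes "S \<in> rainbow r K k" "v \<in> S" "x mod r = v mod r"
  shows "insert x (S - {v}) \<in> rainbow r K k"
proof (rule rainbow_replace)
  show "x mod r \<notin> (\<lambda>n. n mod r) ` (S - {v})"
    using assms(3) rainbowD(5)[OF assms(1) assms(2)] by force
qed (use assms rainbowD(4) in auto)

lemma rainbow_diff_colour:
  "rainbow r (K - {c}) k = {S \<in> rainbow r K k. \<forall>x\<in>S. x mod r \<noteq> c}"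
  by (auto simp: rainbow_def)

lemma rainbow_remove_colour:
  assumes "S \<in> rainbow r K (Suc k)" "x \<in> S"
  shows "S - {x} \<in> rainbow r (K - {x mod r}) k"
  using rainbow_remove[OF assms] rainbowD(5)[OF assms(1) _ assms(2)] by (auto simp: rainbow_diff_colour)

lemma rainbow_insert_colour:
  assumes "S \<in> rainbow r (K - {x mod r}) k" "x mod r \<in> K"
  shows "insert x S \<in> rainbow r K (Suc k)"
  using assms by (intro rainbow_insert) (auto simp: rainbow_diff_colour)

lemma shadow_rainbow: "F \<subseteq> rainbow r K (Suc k) \<Longrightarrow> shadow F \<subseteq> rainbow r K k"
  by (auto elim!: shadowE intro!: rainbow_remove)

lemma finite_shadow_rainbow: "finite F \<Longrightarrow> F \<subseteq> rainbow r K k \<Longrightarrow> finite (shadow F)"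
  by (rule finite_shadow) (auto dest: rainbowD(1))

lemma rainbow_join:
  assumes "B \<subseteq> rainbow r (K - {c}) (Suc k)" "c \<in> K"
    and "\<And>w. w \<in> W \<Longrightarrow> w mod r = c" "\<And>w. w \<in> W \<Longrightarrow> L w \<subseteq> rainbow r (K - {c}) k"
  shows "join W B L \<subseteq> rainbow r K (Suc k)"
proof
  fix X assume "X \<in> join W B L"
  then consider "X \<in> B" | w S where "w \<in> W" "S \<in> L w" "X = insert w S" by (auto simp: join_def)
  then show "X \<in> rainbow r K (Suc k)"
  proof cases
    case 1 then show ?thesis using assms(1) by (auto simp: rainbow_diff_colour)
  next
    case 2 then show ?thesis using rainbow_insert_colour[of S r K w k] assms by auto
  qed
qed

section \<open>Initial segments of rainbow sets and their shadows\<close>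

definition initial :: "nat \<Rightarrow> nat set \<Rightarrow> nat \<Rightarrow> nat set set \<Rightarrow> bool" where
  "initial r K k I \<longleftrightarrow> finite I \<and> I \<subseteq> rainbow r K k \<and>
     (\<forall>S\<in>I. \<forall>T\<in>rainbow r K k. set_encode T < set_encode S \<longrightarrow> T \<in> I)"

lemma initialD:
  assumes "initial r K k I"
  shows "finite I" "I \<subseteq> rainbow r K k"
    and "\<And>S T. S \<in> I \<Longrightarrow> T \<in> rainbow r K k \<Longrightarrow> set_encode T < set_encode S \<Longrightarrow> T \<in> I"
  using assms by (auto simp: initial_def)

lemma initial_le:
  assumes "initial r K k I" "S \<in> I" "T \<in> rainbow r K k" "set_encode T \<le> set_encode S"
  shows "T \<in> I"
proof (cases "set_encode T = set_encode S")
  case True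
  then have "T = S"
    using assms initialD(2)[OF assms(1)] by (subst (asm) set_encode_eq) (auto dest: rainbowD(1))
  then show ?thesis using assms by simp
next
  case False
  then show ?thesis using assms initialD(3)[OF assms(1)] by auto
qed

lemma rainbow_linear:
  assumes "S \<in> rainbow r K k" "T \<in> rainbow r K k'" "S \<noteq> T"
  shows "set_encode S < set_encode T \<or> set_encode T < set_encode S"
  using assms set_encode_eq[of S T] rainbowD(1)[OF assms(1)] rainbowD(1)[OF assms(2)] by linarith

text \<open>Initial segments of a linear order are comparable under inclusion, so comparing sizes is
  enough.\<close>

lemma initial_subset:
  assumes I: "initial r K k I" and J: "initial r K k J" and "card I \<le> card J"
  shows "I \<subseteq> J"
proof (rule ccontr)
  assume "\<not> I \<subseteq> J"
  then obtain S where S: "S \<in> I" "S \<notin> J" by blast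
  have "J \<subseteq> I"
  proof
    fix T assume "T \<in> J"
    then show "T \<in> I"
      using S I J initialD(2)[OF I] initialD(2)[OF J] rainbow_linear[of S r K k T]
      by (metis initialD(3) subsetD)
  qed
  with S have "J \<subset> I" by blast
  then have "card J < card I" using initialD(1)[OF I] by (intro psubset_card_mono)
  with assms(3) show False by simp
qed

text \<open>After cancelling \<open>I \<inter> G\<close>, the parts \<open>I - G\<close> and
  \<open>G - I\<close> have equal size, and every set of the former precedes every set of the
  latter.\<close>

lemma sum_initial_less:
  assumes I: "initial r K k I" and G: "finite G" "G \<subseteq> rainbow r K k" "card G = card I" "G \<noteq> I"
  shows "sum set_encode I < sum set_encode G"
proof -
  have fin: "finite I" using initialD(1)[OF I] .
  have card: "card (I - G) = card (G - I)"
    using card_Diff_subset_Int[of I G] card_Diff_subset_Int[of G I] fin G by (simp add: Int_commute)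
  have ne: "I - G \<noteq> {}"
  proof
    assume "I - G = {}"
    then have "I \<subseteq> G" by blast
    then have "I = G" using G by (intro card_subset_eq) auto
    with G show False by simp
  qed
  have "sum set_encode (I - G) < sum set_encode (G - I)"
  proof (rule sum_less_of_separated)
    fix a b assume "a \<in> I - G" "b \<in> G - I"
    then show "set_encode a < set_encode b"
      using initial_le[OF I, of a b] G by (metis DiffD1 DiffD2 linorder_not_le subsetD)
  qed (use fin G card ne in auto)
  moreover have "sum set_encode I = sum set_encode (I \<inter> G) + sum set_encode (I - G)"
    using fin by (simp add: sum.Int_Diff)
  moreover have "sum set_encode G = sum set_encode (I \<inter> G) + sum set_encode (G - I)"
    using G by (simp add: sum.Int_Diff[of G _ I] Int_commute)
  ultimately show ?thesis by simp
qed

lemma sum_initial_le: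
  assumes "initial r K k I" "finite G" "G \<subseteq> rainbow r K k" "card G = card I"
  shows "sum set_encode I \<le> sum set_encode G"
  using sum_initial_less[OF assms] by (cases "G = I") auto

lemma initial_shadow:
  assumes K: "K \<subseteq> {..<r}" and I: "initial r K (Suc k) I"
  shows "initial r K k (shadow I)"
  unfolding initial_def
proof (intro conjI ballI impI)
  show "finite (shadow I)" "shadow I \<subseteq> rainbow r K k"
    using initialD[OF I] by (auto intro!: finite_shadow_rainbow dest: shadow_rainbow)
next
  fix X Y assume "X \<in> shadow I" and Y: "Y \<in> rainbow r K k" and less: "set_encode Y < set_encode X"
  then obtain A p where A: "A \<in> I" "p \<in> A" and X: "X = A - {p}" by (auto elim: shadowE)
  have AR: "A \<in> rainbow r K (Suc k)" using A initialD(2)[OF I] by auto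
  then have XR: "X \<in> rainbow r K k" using A X by (auto intro: rainbow_remove)
  have fin: "finite A" "finite X" "finite Y" using AR XR Y by (auto dest: rainbowD(1))
  have complete: "Y \<in> shadow I"
    if b: "b mod r \<in> K" "b mod r \<notin> (\<lambda>n. n mod r) ` Y" "set_encode (insert b Y) \<le> set_encode A" for b
  proof -
    have "insert b Y \<in> rainbow r K (Suc k)" using b Y by (intro rainbow_insert)
    then have "insert b Y \<in> I" using initial_le[OF I] A b by blast
    moreover have "b \<notin> Y" using b by blast
    ultimately show ?thesis by (rule insert_in_shadow)
  qed
  obtain x where x: "x \<in> X" "x \<notin> Y" and above: "\<And>y. x < y \<Longrightarrow> y \<in> Y \<longleftrightarrow> y \<in> X"
    using set_encode_lessE[OF fin(3,2) less] by blast
  have pK: "p mod r \<in> K" using AR A by (auto dest: rainbowD(4))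
  have pX: "p mod r \<notin> (\<lambda>n. n mod r) ` X"
    using rainbowD(5)[OF AR A(2)] X by auto
  show "Y \<in> shadow I"
  proof (cases "\<exists>b<x. b mod r \<in> K - (\<lambda>n. n mod r) ` Y")
    case True
    then obtain b where b: "b < x" "b mod r \<in> K" "b mod r \<notin> (\<lambda>n. n mod r) ` Y" by auto
    have "set_encode (insert b Y) < set_encode A"
      by (rule set_encode_less[of _ _ x]) (use fin b x X above in auto)
    with b show ?thesis by (intro complete) auto
  next
    case no_low: False
    show ?thesis
    proof (cases "p mod r \<in> (\<lambda>n. n mod r) ` Y")
      case False
      have "p \<notin> Y" "p \<notin> X" using False X by auto
      then have "set_encode (insert p Y) < set_encode (insert p X)"
        using fin less by simp
      also have "insert p X = A" using A X by auto
      finally show ?thesis using False pK by (intro complete[of p]) auto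
    next
      case True
      then obtain q where q: "q \<in> Y" "q mod r = p mod r" by auto
      then have "q \<notin> X" using pX by (metis imageI)
      then have "q < x" using above[of q] q x by (metis linorder_neqE_nat)
      \<comment> \<open>\<open>Y\<close> uses the colour of \<open>p\<close>, which \<open>X\<close>
        lacks, and has as many colours as \<open>X\<close>, so some colour of \<open>X\<close> is
        missing in \<open>Y\<close>.\<close>
      have "card ((\<lambda>n. n mod r) ` X) = card ((\<lambda>n. n mod r) ` Y)"
        using card_colours[OF XR] card_colours[OF Y] by simp
      then have "\<not> (\<lambda>n. n mod r) ` X \<subseteq> (\<lambda>n. n mod r) ` Y"
        using card_subset_eq[of "(\<lambda>n. n mod r) ` Y" "(\<lambda>n. n mod r) ` X"] fin True pX by auto
      \<comment> \<open>Such a vertex \<open>z\<close> of \<open>X\<close> cannot exceed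
        \<open>x\<close>, above which \<open>X\<close> and \<open>Y\<close> agree, and by
        \<open>no_low\<close> the lowest vertex of its colour is not below \<open>x\<close>. Hence
        \<open>z = z mod r = x\<close>.\<close>
      have unique: "z = x \<and> x < r" if z: "z \<in> X" "z mod r \<notin> (\<lambda>n. n mod r) ` Y" for z
      proof -
        have "z mod r \<in> K" using XR z by (auto dest: rainbowD(4))
        then have "z mod r < r" using K by auto
        have "\<not> z mod r < x" using no_low z \<open>z mod r \<in> K\<close> by (metis DiffI mod_mod_trivial)
        have "\<not> x < z" using above z by auto
        moreover have "z mod r \<le> z" by simp
        ultimately show ?thesis using \<open>\<not> z mod r < x\<close> \<open>z mod r < r\<close> by linarith
      qed
      obtain z where "z \<in> X" "z mod r \<notin> (\<lambda>n. n mod r) ` Y"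
        using \<open>\<not> (\<lambda>n. n mod r) ` X \<subseteq> (\<lambda>n. n mod r) ` Y\<close> by auto
      with unique have xY: "x mod r \<notin> (\<lambda>n. n mod r) ` Y" and "x < r" by auto
      have "q < r" using \<open>q < x\<close> \<open>x < r\<close> by simp
      \<comment> \<open>\<open>Y\<close> has only level-zero vertices below \<open>x\<close>, hence \<open>insert x Y\<close> can be compared with
        \<open>insert q X\<close>, which uses the same colours.\<close>
      define C where "C = insert q X"
      have "(\<lambda>n. n mod r) ` (insert x Y) = (\<lambda>n. n mod r) ` C"
      proof (rule sym, rule card_subset_eq)
        show "(\<lambda>n. n mod r) ` C \<subseteq> (\<lambda>n. n mod r) ` (insert x Y)"
          using unique q unfolding C_def by blast
        show "card ((\<lambda>n. n mod r) ` C) = card ((\<lambda>n. n mod r) ` insert x Y)"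
          using fin xY q pX card_colours[OF XR] card_colours[OF Y] by (simp add: C_def)
      qed (use fin in auto)
      have "insert x Y \<subseteq> C"
      proof
        fix y assume y: "y \<in> insert x Y"
        consider "x < y" | "x = y" | "y < x" by linarith
        then show "y \<in> C"
        proof cases
          case 3
          with \<open>x < r\<close> have "y mod r = y" by simp
          obtain z where z: "z \<in> C" "z mod r = y mod r"
            using \<open>_ = (\<lambda>n. n mod r) ` C\<close> y by (metis imageE imageI)
          have "z \<le> x"
          proof (rule ccontr)
            assume "\<not> z \<le> x"
            then have "z \<in> Y" using z above \<open>q < x\<close> by (auto simp: C_def)
            then have "z = y" using z y 3 rainbowD(5)[OF Y] by auto
            with 3 \<open>\<not> z \<le> x\<close> show False by simp
          qed
          then have "z = y" using z \<open>y mod r = y\<close> \<open>x < r\<close> by simp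
          with z show ?thesis by simp
        qed (use y x above in \<open>auto simp: C_def\<close>)
      qed
      then have "set_encode (insert x Y) \<le> set_encode C"
        using fin by (intro set_encode_mono) (auto simp: C_def)
      also have "\<dots> \<le> set_encode (insert p X)"
      proof -
        have "p \<notin> X" using X by simp
        \<comment> \<open>Since \<open>q < r\<close>, it is the lowest vertex of the colour of
          \<open>p\<close>.\<close>
        have "q \<le> p" using q \<open>q < r\<close> by (metis mod_less mod_less_eq_dividend)
        then show ?thesis using \<open>q \<notin> X\<close> \<open>p \<notin> X\<close> fin by (simp add: C_def power_increasing)
      qed
      also have "insert p X = A" using A X by auto
      finally show ?thesis using xY x XR by (intro complete[of x]) (auto dest: rainbowD(4))
    qed
  qed
qed

subsection \<open>Compression\<close>

text \<open>Shadows of initial segments are initial, so \<open>shadow B\<close> and all links nest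
  inside \<open>J\<close>, and their union costs at most \<open>card J\<close>.\<close>

lemma card_shadow_join_initial:
  assumes "finite W" "\<And>w. w \<in> W \<Longrightarrow> w mod r = c" and K: "K \<subseteq> {..<r}"
    and B: "initial r (K - {c}) (Suc k) B"
    and L: "\<And>w. w \<in> W \<Longrightarrow> initial r (K - {c}) k (L w)"
    and J: "initial r (K - {c}) k J"
    and "card (shadow B) \<le> card J" "\<And>w. w \<in> W \<Longrightarrow> card (L w) \<le> card J"
  shows "card (shadow (join W B L)) \<le> card J + (\<Sum>w\<in>W. card (shadow (L w)))"
proof -
  have disj: "S \<inter> W = {}" "finite S" if "S \<in> rainbow r (K - {c}) j" for S j
    using that assms(2) by (auto simp: rainbow_diff_colour dest: rainbowD(1))
  have "initial r (K - {c}) k (shadow B)"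
    using B K by (intro initial_shadow) auto
  then have "shadow B \<union> (\<Union>w\<in>W. L w) \<subseteq> J"
    using initial_subset[OF _ J] L assms by blast
  then have "card (shadow B \<union> (\<Union>w\<in>W. L w)) \<le> card J"
    using initialD(1)[OF J] by (intro card_mono)
  moreover have "card (shadow (join W B L)) =
      card (shadow B \<union> (\<Union>w\<in>W. L w)) + (\<Sum>w\<in>W. card (shadow (L w)))"
    using assms(1) initialD(1)[OF B] initialD(1)[OF L] initialD(2)[OF B] initialD(2)[OF L] disj
    by (intro card_shadow_join) blast+
  ultimately show ?thesis by simp
qed

definition colour_deletion :: "nat \<Rightarrow> nat \<Rightarrow> nat set set \<Rightarrow> nat set set" where
  "colour_deletion r c F = {S \<in> F. \<forall>x\<in>S. x mod r \<noteq> c}"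

definition vertex_link :: "'a set set \<Rightarrow> 'a \<Rightarrow> 'a set set" where
  "vertex_link F w = {S - {w} |S. S \<in> F \<and> w \<in> S}"

lemma colour_deletion_rainbow:
  "F \<subseteq> rainbow r K k \<Longrightarrow> colour_deletion r c F \<subseteq> rainbow r (K - {c}) k"
  by (auto simp: colour_deletion_def rainbow_diff_colour)

lemma vertex_link_rainbow:
  "F \<subseteq> rainbow r K (Suc k) \<Longrightarrow> vertex_link F w \<subseteq> rainbow r (K - {w mod r}) k"
  by (auto simp: vertex_link_def intro!: rainbow_remove_colour)

lemma join_colour_deletion_vertex_link:
  assumes "F \<subseteq> rainbow r K k"
  shows "join {w \<in> \<Union>F. w mod r = c} (colour_deletion r c F) (vertex_link F) = F"
proof (intro set_eqI iffI)
  fix X assume X: "X \<in> F"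
  show "X \<in> join {w \<in> \<Union>F. w mod r = c} (colour_deletion r c F) (vertex_link F)"
  proof (cases "\<forall>x\<in>X. x mod r \<noteq> c")
    case True
    with X show ?thesis by (auto simp: join_def colour_deletion_def)
  next
    case False
    then obtain w where "w \<in> X" "w mod r = c" by auto
    with X have "w \<in> {w \<in> \<Union>F. w mod r = c}" "X - {w} \<in> vertex_link F w" "X = insert w (X - {w})"
      by (auto simp: vertex_link_def)
    then show ?thesis unfolding join_def by blast
  qed
qed (auto simp: join_def colour_deletion_def vertex_link_def insert_absorb)

text \<open>
  The sum of the encodings is the potential that compressions decrease.
\<close>

definition compressed :: "nat \<Rightarrow> nat set \<Rightarrow> nat \<Rightarrow> nat set set \<Rightarrow> bool" where
  "compressed r K k F \<longleftrightarrow> finite F \<and> F \<subseteq> rainbow r K k \<and>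
     (\<forall>G. finite G \<longrightarrow> G \<subseteq> rainbow r K k \<longrightarrow> card G = card F \<longrightarrow>
        card (shadow G) \<le> card (shadow F) \<longrightarrow> sum set_encode F \<le> sum set_encode G)"

text \<open>The statement of the coloured Kruskal-Katona theorem for the colour set
  \<open>K\<close>, named so that it can serve as induction hypothesis for
  \<open>K - {c}\<close>.\<close>

definition initial_optimal :: "nat \<Rightarrow> nat set \<Rightarrow> bool" where
  "initial_optimal r K \<longleftrightarrow> (\<forall>k F. finite F \<longrightarrow> F \<subseteq> rainbow r K k \<longrightarrow>
     (\<exists>I. initial r K k I \<and> card I = card F \<and> card (shadow I) \<le> card (shadow F)))"

text \<open>Replacing the deletion of colour \<open>c\<close> and every link of a vertex of that
  colour by initial segments of the same sizes neither enlarges the shadow nor raises the potential.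
  Minimality of the potential leaves no room for a change.\<close>

lemma compressed_parts_initial:
  assumes K: "K \<subseteq> {..<r}" and c: "c \<in> K" and IH: "initial_optimal r (K - {c})"
    and F: "compressed r K (Suc k) F"
  shows "initial r (K - {c}) (Suc k) (colour_deletion r c F)"
    and "\<And>w. w mod r = c \<Longrightarrow> w \<in> \<Union>F \<Longrightarrow> initial r (K - {c}) k (vertex_link F w)"
proof -
  have FR: "finite F" "F \<subseteq> rainbow r K (Suc k)" using F by (auto simp: compressed_def)
  define W where "W = {w \<in> \<Union>F. w mod r = c}"
  define B where "B = colour_deletion r c F"
  have finW: "finite W"
    unfolding W_def by (rule finite_subset[of _ "\<Union>F"]) (use FR in \<open>auto dest: rainbowD(1)\<close>)
  have FJ: "join W B (vertex_link F) = F"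
    unfolding W_def B_def by (rule join_colour_deletion_vertex_link[OF FR(2)])
  have B: "finite B" "B \<subseteq> rainbow r (K - {c}) (Suc k)"
    using FR colour_deletion_rainbow[OF FR(2)] by (auto simp: B_def colour_deletion_def)
  have L: "finite (vertex_link F w)" "vertex_link F w \<subseteq> rainbow r (K - {c}) k" if "w \<in> W" for w
    using FR vertex_link_rainbow[OF FR(2), of w] that by (auto simp: W_def vertex_link_def)
  have disj: "S \<inter> W = {}" "finite S" if "S \<in> rainbow r (K - {c}) j" for S j
    using that by (auto simp: rainbow_diff_colour W_def dest: rainbowD(1))
  obtain B' where B': "initial r (K - {c}) (Suc k) B'" "card B' = card B"
    "card (shadow B') \<le> card (shadow B)"
    using IH B unfolding initial_optimal_def by blast
  have "\<exists>I. initial r (K - {c}) k I \<and> card I = card (vertex_link F w) \<and>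
      card (shadow I) \<le> card (shadow (vertex_link F w))" if "w \<in> W" for w
    using IH L[OF that] unfolding initial_optimal_def by blast
  then obtain L' where L': "\<And>w. w \<in> W \<Longrightarrow> initial r (K - {c}) k (L' w)"
    "\<And>w. w \<in> W \<Longrightarrow> card (L' w) = card (vertex_link F w)"
    "\<And>w. w \<in> W \<Longrightarrow> card (shadow (L' w)) \<le> card (shadow (vertex_link F w))"
    by metis
  \<comment> \<open>\<open>D\<close> is the part of the shadow of \<open>F\<close> without colour
    \<open>c\<close>. An initial segment of that size has room for \<open>shadow B'\<close> and
    every \<open>L' w\<close>.\<close>
  define D where "D = shadow B \<union> (\<Union>w\<in>W. vertex_link F w)"
  have D: "finite D" "D \<subseteq> rainbow r (K - {c}) k"
    using B L finW shadow_rainbow[OF B(2)] finite_shadow_rainbow[OF B] by (auto simp: D_def)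
  then obtain J where J: "initial r (K - {c}) k J" "card J = card D"
    using IH unfolding initial_optimal_def by blast
  define F' where "F' = join W B' L'"
  have F': "F' \<subseteq> rainbow r K (Suc k)"
    unfolding F'_def by (rule rainbow_join[OF _ c])
      (use B' L' in \<open>auto simp: W_def dest: initialD(2)\<close>)
  have finF': "finite F'"
    unfolding F'_def join_def using initialD(1)[OF B'(1)] initialD(1)[OF L'(1)] finW by auto
  have disj': "S \<inter> W = {}" "finite S" if "S \<in> B' \<or> (\<exists>w\<in>W. S \<in> L' w)" for S
  proof -
    from that obtain j where "S \<in> rainbow r (K - {c}) j"
      using initialD(2)[OF B'(1)] initialD(2)[OF L'(1)] by blast
    then show "S \<inter> W = {}" "finite S" by (rule disj)+
  qed
  have disjF: "S \<inter> W = {}" "finite S" if "S \<in> B \<or> (\<exists>w\<in>W. S \<in> vertex_link F w)" for S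
  proof -
    from that obtain j where "S \<in> rainbow r (K - {c}) j" using B(2) L(2) by blast
    then show "S \<inter> W = {}" "finite S" by (rule disj)+
  qed
  have disjB: "S \<inter> W = {}" "finite S" if "S \<in> B" for S
    using disjF[of S] that by blast+
  have disjL: "S \<inter> W = {}" "finite S" if "w \<in> W" "S \<in> vertex_link F w" for w S
    using disjF[of S] that by blast+
  have sumF: "sum f F = sum f B + (\<Sum>w\<in>W. \<Sum>S\<in>vertex_link F w. f (insert w S))"
    for f :: "nat set \<Rightarrow> nat"
    by (subst FJ[symmetric], rule sum_join) (rule finW B L disjB disjL; assumption)+
  have sumF': "sum f F' = sum f B' + (\<Sum>w\<in>W. \<Sum>S\<in>L' w. f (insert w S))"
    for f :: "nat set \<Rightarrow> nat"
    unfolding F'_def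
    by (rule sum_join) (use finW initialD(1)[OF B'(1)] initialD(1)[OF L'(1)] disj' in auto)
  have card: "card F' = card F"
    unfolding card_eq_sum sumF sumF' using B'(2) L'(2) by simp
  have "card (shadow F') \<le> card J + (\<Sum>w\<in>W. card (shadow (L' w)))"
    unfolding F'_def
  proof (rule card_shadow_join_initial[OF finW _ K B'(1) L'(1) J(1)])
    show "card (shadow B') \<le> card J"
      using B'(3) J(2) card_mono[OF D(1), of "shadow B"] by (simp add: D_def)
    show "card (L' w) \<le> card J" if "w \<in> W" for w
      using L'(2)[OF that] J(2) card_mono[OF D(1), of "vertex_link F w"] that by (auto simp: D_def)
  qed (auto simp: W_def)
  also have "\<dots> \<le> card D + (\<Sum>w\<in>W. card (shadow (vertex_link F w)))"
    using J(2) L'(3) by (simp add: sum_mono)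
  also have "\<dots> = card (shadow (join W B (vertex_link F)))"
    unfolding D_def by (rule card_shadow_join[symmetric]) (rule finW B L disjB disjL; assumption)+
  finally have "sum set_encode F \<le> sum set_encode F'"
    using F finF' F' card FJ unfolding compressed_def by simp
  moreover have encF: "sum set_encode F =
      sum set_encode B + (\<Sum>w\<in>W. card (vertex_link F w) * 2 ^ w + sum set_encode (vertex_link F w))"
    unfolding sumF by (intro arg_cong2[of _ _ _ _ "(+)"] sum.cong refl)
      (subst sum.cong[OF refl set_encode_insert]; use disjF in \<open>force simp: sum.distrib\<close>)
  moreover have encF': "sum set_encode F' =
      sum set_encode B' + (\<Sum>w\<in>W. card (vertex_link F w) * 2 ^ w + sum set_encode (L' w))"
    unfolding sumF' L'(2)[symmetric] by (intro arg_cong2[of _ _ _ _ "(+)"] sum.cong refl)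
      (subst sum.cong[OF refl set_encode_insert]; use disj' L' in \<open>force simp: sum.distrib\<close>)
  \<comment> \<open>Coning over \<open>w\<close> adds \<open>2 ^ w\<close> for each member of the
    link. The links keep their sizes, so these terms cancel.\<close>
  ultimately have le: "sum set_encode B + (\<Sum>w\<in>W. sum set_encode (vertex_link F w)) \<le>
      sum set_encode B' + (\<Sum>w\<in>W. sum set_encode (L' w))"
    by (simp add: sum.distrib)
  \<comment> \<open>Each part has potential at least that of its replacement, so \<open>le\<close>
    forces equality in every part; an initial segment is the only minimiser of its size.\<close>
  have leB: "sum set_encode B' \<le> sum set_encode B"
    using B B' by (intro sum_initial_le) auto
  have leL: "sum set_encode (L' w) \<le> sum set_encode (vertex_link F w)" if "w \<in> W" for w
    using L L' that by (intro sum_initial_le) auto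
  have leS: "(\<Sum>w\<in>W. sum set_encode (L' w)) \<le> (\<Sum>w\<in>W. sum set_encode (vertex_link F w))"
    by (rule sum_mono) (rule leL)
  have "B = B'"
    using sum_initial_less[OF B'(1) B] B'(2) leS le by fastforce
  then show "initial r (K - {c}) (Suc k) (colour_deletion r c F)" using B' by (simp add: B_def)
  fix w assume w: "w mod r = c" "w \<in> \<Union>F"
  then have "w \<in> W" by (simp add: W_def)
  have "vertex_link F w = L' w"
  proof (rule ccontr)
    assume "vertex_link F w \<noteq> L' w"
    then have "sum set_encode (L' w) < sum set_encode (vertex_link F w)"
      using sum_initial_less[OF L'(1)[OF \<open>w \<in> W\<close>] L[OF \<open>w \<in> W\<close>]] L'(2)[OF \<open>w \<in> W\<close>] by simp
    then have "(\<Sum>w\<in>W. sum set_encode (L' w)) < (\<Sum>w\<in>W. sum set_encode (vertex_link F w))"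
      using \<open>w \<in> W\<close> leL finW by (intro sum_strict_mono_ex1) auto
    then show False using le leB by simp
  qed
  then show "initial r (K - {c}) k (vertex_link F w)" using L'(1)[OF \<open>w \<in> W\<close>] by simp
qed

text \<open>The two alternatives say that \<open>S\<close> and \<open>T\<close> share a link, that
  of a common vertex, or a deletion, that of a colour in \<open>K\<close> missing from both. Each of
  these parts of a compressed family is initial under the induction hypothesis.\<close>

definition agree :: "nat \<Rightarrow> nat set \<Rightarrow> nat set \<Rightarrow> nat set \<Rightarrow> bool" where
  "agree r K S T \<longleftrightarrow> S \<inter> T \<noteq> {} \<or> \<not> K \<subseteq> (\<lambda>n. n mod r) ` (S \<union> T)"

lemma agreeI: "w \<in> S \<Longrightarrow> w \<in> T \<Longrightarrow> agree r K S T"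
  by (auto simp: agree_def)

lemma agreeI':
  "c \<in> K \<Longrightarrow> c \<notin> (\<lambda>n. n mod r) ` S \<Longrightarrow> c \<notin> (\<lambda>n. n mod r) ` T \<Longrightarrow> agree r K S T"
  by (auto simp: agree_def)

text \<open>The common link or deletion is initial by \<open>compressed_parts_initial\<close>, and
  removing a common vertex from both sets keeps their order.\<close>

lemma compressed_closed:
  assumes K: "K \<subseteq> {..<r}" and IH: "\<And>c. c \<in> K \<Longrightarrow> initial_optimal r (K - {c})"
    and F: "compressed r K (Suc k) F"
    and T: "T \<in> F" and S: "S \<in> rainbow r K (Suc k)" and less: "set_encode S < set_encode T"
    and "agree r K S T"
  shows "S \<in> F"
proof -
  have FR: "F \<subseteq> rainbow r K (Suc k)" using F by (auto simp: compressed_def)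
  have TR: "T \<in> rainbow r K (Suc k)" using FR T by auto
  from \<open>agree r K S T\<close> consider w where "w \<in> S" "w \<in> T"
    | c where "c \<in> K" "c \<notin> (\<lambda>n. n mod r) ` S" "c \<notin> (\<lambda>n. n mod r) ` T"
    unfolding agree_def by auto
  then show ?thesis
  proof cases
    case 1
    have I: "initial r (K - {w mod r}) k (vertex_link F w)"
      using compressed_parts_initial(2)[OF K _ IH F] 1 T rainbowD(4)[OF TR] by blast
    have "set_encode (S - {w}) < set_encode (T - {w})"
      using set_encode_insert_less_iff[of "S - {w}" "T - {w}" w] less 1
        rainbowD(1)[OF S] rainbowD(1)[OF TR] by (simp add: insert_absorb)
    moreover have "T - {w} \<in> vertex_link F w" using T 1 by (auto simp: vertex_link_def)
    ultimately have "S - {w} \<in> vertex_link F w"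
      using initialD(3)[OF I] rainbow_remove_colour[OF S] 1 by blast
    then obtain R where "R \<in> F" "w \<in> R" "S - {w} = R - {w}" by (auto simp: vertex_link_def)
    moreover from this have "S = R" using 1 by blast
    ultimately show ?thesis by simp
  next
    case 2
    have I: "initial r (K - {c}) (Suc k) (colour_deletion r c F)"
      using compressed_parts_initial(1)[OF K _ IH F] 2 by blast
    have "T \<in> colour_deletion r c F" using T 2 by (auto simp: colour_deletion_def)
    moreover have "S \<in> rainbow r (K - {c}) (Suc k)" using S 2 by (auto simp: rainbow_diff_colour)
    ultimately have "S \<in> colour_deletion r c F" using initialD(3)[OF I] less by blast
    then show ?thesis by (simp add: colour_deletion_def)
  qed
qed

subsection \<open>The coloured Kruskal--Katona theorem\<close>

lemma compressedD:
  assumes "compressed r K k F" "finite G" "G \<subseteq> rainbow r K k" "card G = card F"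
    and "card (shadow G) \<le> card (shadow F)"
  shows "sum set_encode F \<le> sum set_encode G"
  using assms by (simp add: compressed_def)

text \<open>Exchanging \<open>G\<close> for earlier missing sets keeps the size and lowers the
  potential; minimality then forces the shadow to grow.\<close>

lemma compressed_not_improvable:
  assumes F: "compressed r K k F"
    and G: "G \<subseteq> F" "G \<noteq> {}" and H: "finite H" "H \<subseteq> rainbow r K k" "H \<inter> F = {}" "card H = card G"
    and less: "\<And>S T. S \<in> H \<Longrightarrow> T \<in> G \<Longrightarrow> set_encode S < set_encode T"
  shows "card (shadow F) < card (shadow (F - G \<union> H))"
proof (rule ccontr)
  assume *: "\<not> card (shadow F) < card (shadow (F - G \<union> H))"
  have fin: "finite F" "F \<subseteq> rainbow r K k" using F by (auto simp: compressed_def)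
  then have finG: "finite G" using G finite_subset by blast
  have "card (F - G \<union> H) = card (F - G) + card H"
    using fin H by (intro card_Un_disjoint) auto
  also have "\<dots> = card F"
    using fin finG G H card_mono[OF fin(1) G(1)] by (simp add: card_Diff_subset)
  finally have "card (F - G \<union> H) = card F" .
  then have "sum set_encode F \<le> sum set_encode (F - G \<union> H)"
  proof -
    have "F - G \<union> H \<subseteq> rainbow r K k" "finite (F - G \<union> H)" using fin H by auto
    then show ?thesis
      using * \<open>card (F - G \<union> H) = card F\<close> by (intro compressedD[OF F]) auto
  qed
  also have "\<dots> = sum set_encode (F - G) + sum set_encode H"
    using fin H by (intro sum.union_disjoint) auto
  also have "\<dots> < sum set_encode (F - G) + sum set_encode G"
  proof -
    have "H \<noteq> {}" using H(4) G finG by auto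
    then show ?thesis
      using sum_less_of_separated[of H G set_encode] H finG less by simp
  qed
  also have "\<dots> = sum set_encode F"
    using G fin by (simp add: sum.subset_diff[of G F])
  finally show False by simp
qed

text \<open>
  Suppose \<open>S\<close> is the least missing set and \<open>T\<close> the last member of \<open>F\<close>. No chain
  \<open>S < U < T\<close> of consecutively agreeing sets exists, and exchanging \<open>T\<close> for \<open>S\<close> must create a new
  shadow element \<open>S - {v}\<close>. This forces \<open>v\<close> to be the first vertex of the colour of \<open>t = Max T\<close> and
  \<open>S\<close>, \<open>T\<close> to use all colours, with \<open>S\<close> above \<open>T\<close> in every other colour. Then exchanging all members
  containing \<open>T - {u}\<close> for as many sets \<open>S - {v} \<union> {v + i r}\<close> creates only \<open>S - {v}\<close> and
  destroys \<open>T - {u}\<close> in the shadow.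
\<close>

lemma compressed_initial:
  assumes K: "K \<subseteq> {..<r}" and IH: "\<And>c. c \<in> K \<Longrightarrow> initial_optimal r (K - {c})"
    and F: "compressed r K k F"
  shows "initial r K k F"
proof (rule ccontr)
  assume not_initial: "\<not> initial r K k F"
  have FR: "finite F" "F \<subseteq> rainbow r K k" using F by (auto simp: compressed_def)
  have finR: "finite S" if "S \<in> rainbow r K k" for S using that by (rule rainbowD(1))
  have "\<exists>S. S \<in> rainbow r K k - F" using not_initial FR by (auto simp: initial_def)
  then obtain S where S: "S \<in> rainbow r K k" "S \<notin> F"
    and least: "\<And>U. U \<in> rainbow r K k \<Longrightarrow> set_encode U < set_encode S \<Longrightarrow> U \<in> F"
    using ex_has_least_nat[of "\<lambda>S. S \<in> rainbow r K k - F" _ set_encode] by (metis Diff_iff not_less)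
  obtain S0 T0 where S0: "S0 \<in> rainbow r K k" "S0 \<notin> F" "T0 \<in> F" "set_encode S0 < set_encode T0"
    using not_initial FR by (auto simp: initial_def)
  have "Max (set_encode ` F) \<in> set_encode ` F" using S0(3) FR(1) by (intro Max_in) auto
  then obtain T where T: "T \<in> F" "set_encode T = Max (set_encode ` F)" by auto
  then have greatest: "set_encode U \<le> set_encode T" if "U \<in> F" for U
    using that FR(1) by simp
  note T = T(1)
  have TR: "T \<in> rainbow r K k" using T FR by blast
  have ST: "set_encode S < set_encode T"
    using least[OF S0(1)] S0 greatest[OF S0(3)] by linarith
  have "k \<noteq> 0" using S TR ST by (cases "k = 0") (auto simp: rainbow_0)
  then obtain j where k: "k = Suc j" by (cases k) auto
  have closed: "U \<in> F" if "V \<in> F" "U \<in> rainbow r K k" "set_encode U < set_encode V" "agree r K U V" for U V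
    using compressed_closed[OF K IH, of j F V U] F that unfolding k by blast
  have no_chain: False if "U \<in> rainbow r K k" "set_encode S < set_encode U" "set_encode U < set_encode T"
    "agree r K S U" "agree r K U T" for U
    using closed[of T U] closed[of U S] that T S by blast
  \<comment> \<open>\<open>S\<close> and \<open>T\<close> do not agree, since otherwise
    \<open>T \<in> F\<close> would put \<open>S\<close> into \<open>F\<close>.\<close>
  have disj: "S \<inter> T = {}" and cover: "K \<subseteq> (\<lambda>n. n mod r) ` S \<union> (\<lambda>n. n mod r) ` T"
    using closed[OF T S(1) ST] S by (auto simp: agree_def image_Un)
  have fin: "finite S" "finite T" using S TR finR by auto
  obtain t where t: "t \<in> T" and "\<And>y. t < y \<Longrightarrow> y \<in> S \<longleftrightarrow> y \<in> T"
    using set_encode_lessE[OF fin ST] by blast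
  then have "\<not> t < y" if "y \<in> S \<union> T" for y using that disj by blast
  then have tS: "y < t" if "y \<in> S" for y
    using that t disj by (metis Un_iff disjoint_iff linorder_neqE_nat)
  have tT: "y < t" if "y \<in> T" "y \<noteq> t" for y
    using that \<open>\<And>y. y \<in> S \<union> T \<Longrightarrow> \<not> t < y\<close> by (meson UnI2 linorder_neqE_nat)
  have lessT: "set_encode U < set_encode V" if "finite U" "finite V" "t \<in> V" "\<And>y. y \<in> U \<Longrightarrow> y < t" for U V
    using that(1-3) by (intro set_encode_less[of _ _ t]) (auto dest: that(4))
  have "\<not> shadow (F - {T} \<union> {S}) \<subseteq> shadow F"
  proof
    assume "shadow (F - {T} \<union> {S}) \<subseteq> shadow F"
    then have "card (shadow (F - {T} \<union> {S})) \<le> card (shadow F)"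
      using FR by (intro card_mono finite_shadow_rainbow) auto
    moreover have "card (shadow F) < card (shadow (F - {T} \<union> {S}))"
      using F T S ST by (intro compressed_not_improvable) auto
    ultimately show False by simp
  qed
  then obtain v where v: "v \<in> S" and new: "S - {v} \<notin> shadow F"
    by (blast elim!: shadowE intro: shadowI)
  \<comment> \<open>A smaller \<open>w\<close> would give a set before \<open>S\<close>, hence in
    \<open>F\<close> by the choice of \<open>S\<close>, with \<open>S - {v}\<close> in its shadow.
    Applied to \<open>w = v mod r\<close> this puts \<open>v\<close> on level zero.\<close>
  have new': "v \<le> w" if "w mod r \<in> K" "w mod r \<notin> (\<lambda>n. n mod r) ` (S - {v})" for w
  proof (rule ccontr)
    assume "\<not> v \<le> w"
    moreover have "w \<notin> S" using that calculation by auto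
    ultimately have "insert w (S - {v}) \<in> F"
      using that S v fin by (intro least rainbow_replace set_encode_replace) auto
    with \<open>w \<notin> S\<close> new show False using insert_in_shadow[of w "S - {v}" F] by auto
  qed
  have colour: "x mod r \<in> K" if "x \<in> S \<union> T" for x
    using that rainbowD(4)[OF S(1)] rainbowD(4)[OF TR] by blast
  have injS: "x = y" if "x \<in> S" "y \<in> S" "x mod r = y mod r" for x y
    using that rainbowD(5)[OF S(1)] by blast
  have injT: "x = y" if "x \<in> T" "y \<in> T" "x mod r = y mod r" for x y
    using that rainbowD(5)[OF TR] by blast
  have vS: "v mod r \<notin> (\<lambda>n. n mod r) ` (S - {v})"
    using injS[OF v] by auto
  then have "v \<le> v mod r" using colour[of v] v by (intro new') auto
  then have v0: "v mod r = v" by (simp add: le_antisym)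
  have "k \<noteq> 1"
  proof
    assume "k = 1"
    then have "S - {v} = {}" "T - {t} = {}"
      using rainbow_remove[of S r K 0 v] rainbow_remove[of T r K 0 t] S TR v t by (auto simp: rainbow_0)
    with new shadowI[OF T t] show False by simp
  qed
  have two: "\<exists>y\<in>X. y \<noteq> x" if "X \<in> rainbow r K k" for X x
  proof (rule ccontr)
    assume "\<not> (\<exists>y\<in>X. y \<noteq> x)"
    then have "X \<subseteq> {x}" by auto
    then have "card X \<le> 1" using card_mono[of "{x}" X] by simp
    with rainbowD(2)[OF that] \<open>k \<noteq> 0\<close> \<open>k \<noteq> 1\<close> show False by simp
  qed
  obtain v' where v': "v' \<in> S" "v' \<noteq> v" using two[OF S(1)] by blast
  \<comment> \<open>Otherwise \<open>S\<close> with \<open>v\<close> replaced by \<open>d\<close>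
    lies between \<open>S\<close> and \<open>T\<close>, sharing \<open>v'\<close> with
    \<open>S\<close> and \<open>d\<close> with \<open>T\<close>.\<close>
  have A: "d mod r \<in> (\<lambda>n. n mod r) ` S" if d: "d \<in> T" "d \<noteq> t" for d
  proof (rule ccontr)
    assume nd: "d mod r \<notin> (\<lambda>n. n mod r) ` S"
    let ?U = "insert d (S - {v})"
    have "d \<notin> S" using nd by auto
    have "v \<le> d" using nd colour d by (intro new') auto
    then have "v < d" using \<open>d \<notin> S\<close> v by (cases "v = d") auto
    show False
    proof (rule no_chain[of ?U])
      show "?U \<in> rainbow r K k" using nd colour d v S by (intro rainbow_replace) auto
      show "set_encode S < set_encode ?U" using \<open>v < d\<close> \<open>d \<notin> S\<close> fin v by (intro set_encode_replace') auto
      show "set_encode ?U < set_encode T" using tS tT[OF d] fin t by (intro lessT) auto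
      show "agree r K S ?U" using v' by (intro agreeI[of v']) auto
      show "agree r K ?U T" using d by (intro agreeI[of d]) auto
    qed
  qed
  \<comment> \<open>Here the intermediate set is \<open>T\<close> with \<open>d\<close> lowered to
    \<open>v\<close>, which shares \<open>v\<close> with \<open>S\<close> and \<open>t\<close> with
    \<open>T\<close>.\<close>
  have B: "d mod r \<noteq> v" if d: "d \<in> T" "d \<noteq> t" for d
  proof
    assume dv: "d mod r = v"
    let ?U = "insert v (T - {d})"
    have "v \<le> d" using dv mod_less_eq_dividend[of d r] by simp
    moreover have "v \<notin> T" using v disj by auto
    ultimately have "v < d" using d by (cases "v = d") auto
    show False
    proof (rule no_chain[of ?U])
      show "?U \<in> rainbow r K k" using dv v0 d TR by (intro rainbow_replace_same) auto
      show "set_encode S < set_encode ?U" using tS fin t d by (intro lessT) auto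
      show "set_encode ?U < set_encode T"
        using \<open>v < d\<close> \<open>v \<notin> T\<close> fin d by (intro set_encode_replace) auto
      show "agree r K S ?U" using v by (intro agreeI[of v]) auto
      show "agree r K ?U T" using d t by (intro agreeI[of t]) auto
    qed
  qed
  \<comment> \<open>If \<open>t\<close> is on level zero, so are all vertices of \<open>S\<close>
    and \<open>T\<close>, and equal colours would mean equal vertices. Otherwise the lowest vertex
    of the colour of \<open>t\<close> replaces \<open>v\<close> in \<open>S\<close>; the resulting
    set and \<open>T\<close> both miss colour \<open>v\<close>.\<close>
  have tcol: "t mod r \<in> (\<lambda>n. n mod r) ` S"
  proof (rule ccontr)
    assume nt: "t mod r \<notin> (\<lambda>n. n mod r) ` S"
    show False
    proof (cases "t mod r = t")
      case True
      then have "t < r" using K colour[of t] t by auto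
      obtain d where d: "d \<in> T" "d \<noteq> t" using two[OF TR] by blast
      then obtain s where s: "s \<in> S" "d mod r = s mod r" using A by blast
      have "s < r" "d < r" using tS[OF s(1)] tT[OF d] \<open>t < r\<close> by auto
      then have "d = s" using s by simp
      with d s disj show False by blast
    next
      case False
      define c where "c = t mod r"
      have "c < t" using False mod_less_eq_dividend[of t r] unfolding c_def by linarith
      have cK: "c \<in> K" "c mod r = c" "c \<notin> (\<lambda>n. n mod r) ` S"
        using colour[of t] t nt by (auto simp: c_def)
      then have "c \<notin> S" by (metis imageI)
      let ?U = "insert c (S - {v})"
      have "v \<le> c" using cK by (intro new') auto
      then have "v < c" using \<open>c \<notin> S\<close> v by (cases "v = c") auto
      show False
      proof (rule no_chain[of ?U])
        show "?U \<in> rainbow r K k" using cK v S by (intro rainbow_replace) auto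
        show "set_encode S < set_encode ?U" using \<open>v < c\<close> \<open>c \<notin> S\<close> fin v by (intro set_encode_replace') auto
        show "set_encode ?U < set_encode T" using tS \<open>c < t\<close> fin t by (intro lessT) auto
        show "agree r K S ?U" using v' by (intro agreeI[of v']) auto
        show "agree r K ?U T"
        proof (rule agreeI'[of v])
          show "v \<in> K" using colour[of v] v v0 by simp
          show "v \<notin> (\<lambda>n. n mod r) ` ?U" using vS v0 cK \<open>v < c\<close> by auto
          have "t mod r \<noteq> v" using \<open>v < c\<close> by (simp add: c_def)
          then show "v \<notin> (\<lambda>n. n mod r) ` T" using B by force
        qed
      qed
    qed
  qed
  have colours: "(\<lambda>n. n mod r) ` T = (\<lambda>n. n mod r) ` S"
  proof (rule card_subset_eq)
    show "(\<lambda>n. n mod r) ` T \<subseteq> (\<lambda>n. n mod r) ` S" using A tcol by force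
  qed (use fin card_colours[OF S(1)] card_colours[OF TR] in auto)
  then have KS: "K = (\<lambda>n. n mod r) ` S" using cover colour by auto
  have tv: "t mod r = v"
  proof -
    have "v mod r \<in> (\<lambda>n. n mod r) ` T" using v colours by blast
    then show ?thesis using B v0 by force
  qed
  \<comment> \<open>Otherwise replacing \<open>s\<close> by \<open>d\<close> in \<open>S\<close>
    gives an intermediate set sharing \<open>v\<close> with \<open>S\<close> and \<open>d\<close>
    with \<open>T\<close>.\<close>
  have partner: "d < s" if d: "d \<in> T" "d \<noteq> t" and s: "s \<in> S" "s mod r = d mod r" for d s
  proof (rule ccontr)
    assume "\<not> d < s"
    then have "s < d" using d s disj by (metis disjoint_iff linorder_neqE_nat)
    have "s \<noteq> v" using B[OF d] s v0 by auto
    have "d \<notin> S" using d disj by auto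
    let ?U = "insert d (S - {s})"
    show False
    proof (rule no_chain[of ?U])
      show "?U \<in> rainbow r K k" using S s by (intro rainbow_replace_same) auto
      show "set_encode S < set_encode ?U" using \<open>s < d\<close> \<open>d \<notin> S\<close> fin s by (intro set_encode_replace') auto
      show "set_encode ?U < set_encode T" using tS tT[OF d] fin t by (intro lessT) auto
      show "agree r K S ?U" using v \<open>s \<noteq> v\<close> by (intro agreeI[of v]) auto
      show "agree r K ?U T" using d by (intro agreeI[of d]) auto
    qed
  qed

  \<comment> \<open>Exchange of several sets at once\<close>
  obtain u where u: "u \<in> T" "u \<noteq> t" using two[OF TR] by blast
  obtain s where s: "s \<in> S" "s mod r = u mod r" using A[OF u] by force
  define G where "G = {U \<in> F. T - {u} \<subseteq> U}"
  define W where "W i = insert (v + i * r) (S - {v})" for i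
  define H where "H = W ` {..<card G}"
  have "r > 0" using K colour[of t] t by (cases r) auto
  \<comment> \<open>A member of \<open>G\<close> arises from \<open>T\<close> by moving
    \<open>u\<close> within its colour: all other colours are taken. The level cannot rise because
    \<open>T\<close> is the last member of \<open>F\<close>, so \<open>card G\<close> is at most the
    number of levels up to that of \<open>u\<close>.\<close>
  have "G \<subseteq> (\<lambda>i. insert (u mod r + i * r) (T - {u})) ` {..u div r}"
  proof
    fix U assume "U \<in> G"
    then have U: "U \<in> F" "T - {u} \<subseteq> U" by (auto simp: G_def)
    then have UR: "U \<in> rainbow r K k" using FR by auto
    have "card (U - (T - {u})) = 1"
      using card_Diff_subset[of "T - {u}" U] U fin u rainbowD(2)[OF UR] rainbowD(2)[OF TR] \<open>k \<noteq> 0\<close>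
      by simp
    then obtain x where x: "U - (T - {u}) = {x}" by (auto simp: card_1_singleton_iff)
    then have Ux: "U = insert x (T - {u})" "x \<notin> T - {u}" using U by auto
    have "x mod r = u mod r"
    proof (rule ccontr)
      assume ne: "x mod r \<noteq> u mod r"
      have "x mod r \<in> (\<lambda>n. n mod r) ` T" using rainbowD(4)[OF UR, of x] KS colours Ux by auto
      then obtain y where y: "y \<in> T" "x mod r = y mod r" by auto
      with ne have "y \<in> U" using Ux by auto
      then have "x = y" using rainbowD(5)[OF UR, of x y] y Ux by auto
      with y ne Ux show False by auto
    qed
    have "x \<le> u"
    proof (rule ccontr)
      assume "\<not> x \<le> u"
      then have "set_encode T < set_encode U"
        using Ux u fin by (simp only:) (rule set_encode_replace', auto)
      with greatest[OF U(1)] show False by simp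
    qed
    moreover have "x = u mod r + (x div r) * r" using \<open>x mod r = u mod r\<close>[symmetric] by simp
    ultimately show "U \<in> (\<lambda>i. insert (u mod r + i * r) (T - {u})) ` {..u div r}"
      using Ux by (auto intro!: image_eqI[of _ _ "x div r"] div_le_mono)
  qed
  then have "card G \<le> card ((\<lambda>i. insert (u mod r + i * r) (T - {u})) ` {..u div r})"
    by (intro card_mono) auto
  also have "\<dots> \<le> u div r + 1"
    using card_image_le[of "{..u div r}" "\<lambda>i. insert (u mod r + i * r) (T - {u})"] by simp
  \<comment> \<open>\<open>s\<close> lies above \<open>u\<close> in the same colour, hence on a
    higher level. This absorbs the \<open>+ 1\<close> and keeps all \<open>v + i * r\<close> with
    \<open>i < card G\<close> below \<open>t\<close>.\<close>
  also have "u div r < s div r"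
  proof -
    have "u < s" using partner u s by blast
    then have "u div r \<le> s div r" by (simp add: div_le_mono)
    moreover have "u div r \<noteq> s div r" using s \<open>u < s\<close> by (metis div_mod_decomp nat_neq_iff)
    ultimately show ?thesis by simp
  qed
  then have "u div r + 1 \<le> s div r" by simp
  also have "s div r \<le> t div r" using tS[OF s(1)] by (simp add: div_le_mono)
  finally have cardG: "card G \<le> t div r" .
  have below: "v + i * r < t" if "i < t div r" for i
  proof -
    have "i * r < (t div r) * r" using that \<open>r > 0\<close> by simp
    then show ?thesis using tv div_mult_mod_eq[of t r] by linarith
  qed
  have WR: "W i \<in> rainbow r K k" for i
    unfolding W_def using S v by (intro rainbow_replace_same) auto
  have v_new: "v + i * r \<notin> S - {v}" for i
    using vS v0 by (metis imageI mod_mult_self1)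
  \<comment> \<open>For \<open>i > 0\<close>, \<open>W i\<close> comes after \<open>S\<close> and
    shares \<open>v'\<close> with it, so with \<open>W i\<close> also \<open>S\<close> would lie in
    \<open>F\<close>.\<close>
  have W_notin: "W i \<notin> F" for i
  proof
    assume W: "W i \<in> F"
    show False
    proof (cases "i = 0")
      case True
      then have "W i = S" using v by (auto simp: W_def)
      with W S show False by simp
    next
      case False
      have "set_encode S < set_encode (W i)"
        unfolding W_def using False v fin v_new[of i] \<open>r > 0\<close> by (intro set_encode_replace') auto
      moreover have "agree r K S (W i)" using v' by (intro agreeI[of v']) (auto simp: W_def)
      ultimately show False using closed[OF W S(1)] S(2) by blast
    qed
  qed
  have "inj W"
  proof (rule injI)
    fix i j assume "W i = W j"
    then have "v + i * r = v + j * r" using v_new[of i] v_new[of j] unfolding W_def by blast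
    then show "i = j" using \<open>r > 0\<close> by simp
  qed
  have WT: "y < t" if "i < card G" "y \<in> W i" for i y
    using that below[of i] cardG tS by (auto simp: W_def)
  have "card (shadow F) < card (shadow (F - G \<union> H))"
  proof (rule compressed_not_improvable[OF F])
    show "G \<noteq> {}" using T by (auto simp: G_def)
    show "card H = card G" unfolding H_def using \<open>inj W\<close>
      by (simp add: card_image inj_on_subset)
    show "set_encode X < set_encode Y" if "X \<in> H" "Y \<in> G" for X Y
      using that WT t u FR finR WR by (intro lessT) (auto simp: H_def G_def)
  qed (use WR W_notin in \<open>auto simp: G_def H_def\<close>)
  moreover have "shadow (F - G \<union> H) \<subseteq> insert (S - {v}) (shadow F - {T - {u}})"
  proof
    fix X assume "X \<in> shadow (F - G \<union> H)"
    then consider U y where "U \<in> F" "U \<notin> G" "y \<in> U" "X = U - {y}"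
      | i y where "i < card G" "y \<in> W i" "X = W i - {y}"
      by (auto elim!: shadowE simp: H_def)
    then show "X \<in> insert (S - {v}) (shadow F - {T - {u}})"
    proof cases
      case 1
      then have "X \<in> shadow F" using shadowI by simp
      moreover have "X \<noteq> T - {u}" using 1 unfolding G_def by blast
      ultimately show ?thesis by simp
    next
      case (2 i y)
      have "t \<notin> X" using WT[OF 2(1)] 2(3) by blast
      then have ne: "X \<noteq> T - {u}" using t u by blast
      show ?thesis
      proof (cases "y = v + i * r")
        case True
        then show ?thesis using 2 v_new[of i] by (auto simp: W_def)
      next
        case False
        then have y: "y \<in> S" "y \<noteq> v" using 2 by (auto simp: W_def)
        \<comment> \<open>\<open>X\<close> lacks the colour of \<open>y\<close>. Completing it by
          the vertex \<open>d\<close> of \<open>T\<close> in that colour gives a set before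
          \<open>T\<close> that agrees with it, hence a member of \<open>F\<close>.\<close>
        obtain d where d: "d \<in> T" "d mod r = y mod r" using colours y by force
        have "d \<noteq> t" using d tv v0 injS[of y v] y v by auto
        have "d \<notin> X"
        proof
          assume "d \<in> X"
          then have "d \<in> W i" "d \<noteq> y" using 2 by auto
          with rainbowD(5)[OF WR[of i], of d y] d 2 show False by auto
        qed
        have "insert d X \<in> rainbow r K k"
          unfolding 2(3) using WR 2 d by (intro rainbow_replace_same) auto
        moreover have "set_encode (insert d X) < set_encode T"
          using WT[OF 2(1)] tT[OF d(1) \<open>d \<noteq> t\<close>] t fin finR[OF WR[of i]] 2(3) by (intro lessT) auto
        ultimately have "insert d X \<in> F"
          using d by (intro closed[OF T] agreeI[of d]) auto
        then have "X \<in> shadow F" using \<open>d \<notin> X\<close> by (rule insert_in_shadow)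
        with ne show ?thesis by simp
      qed
    qed
  qed
  then have "card (shadow (F - G \<union> H)) \<le> card (insert (S - {v}) (shadow F - {T - {u}}))"
    using finite_shadow_rainbow[OF FR] by (intro card_mono) auto
  moreover have "card (insert (S - {v}) (shadow F - {T - {u}})) \<le> card (shadow F)"
  proof -
    have "T - {u} \<in> shadow F" using T u by (intro shadowI)
    then have "card (shadow F - {T - {u}}) < card (shadow F)"
      using finite_shadow_rainbow[OF FR] by (intro psubset_card_mono) auto
    moreover have "card (insert (S - {v}) (shadow F - {T - {u}})) \<le> Suc (card (shadow F - {T - {u}}))"
      using finite_shadow_rainbow[OF FR] by (simp add: card_insert_if)
    ultimately show ?thesis by linarith
  qed
  ultimately show False by simp
qed

text \<open>Among the families of the given size whose shadow is no larger than that of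
  \<open>F\<close>, one of least potential is compressed, hence initial. Induction over subsets of
  \<open>K\<close> supplies the hypothesis for \<open>K - {c}\<close>.\<close>

theorem coloured_kruskal_katona:
  assumes "K \<subseteq> {..<r}"
  shows "initial_optimal r K"
proof -
  have "finite K" using assms finite_subset by blast
  then show ?thesis using assms
  proof (induction K rule: finite_psubset_induct)
    case (psubset K)
    show ?case
      unfolding initial_optimal_def
    proof (intro allI impI)
      fix k F assume F: "finite F" "F \<subseteq> rainbow r K k"
      define P where "P G \<longleftrightarrow> finite G \<and> G \<subseteq> rainbow r K k \<and> card G = card F \<and>
        card (shadow G) \<le> card (shadow F)" for G
      have "P F" using F by (simp add: P_def)
      then obtain G where G: "P G" "\<And>G'. P G' \<Longrightarrow> sum set_encode G \<le> sum set_encode G'"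
        using ex_has_least_nat[of P F "sum set_encode"] by blast
      then have "compressed r K k G"
        unfolding compressed_def P_def by auto
      moreover have "initial_optimal r (K - {c})" if "c \<in> K" for c
        using that psubset.prems by (intro psubset.IH) auto
      ultimately have "initial r K k G" by (intro compressed_initial[OF psubset.prems])
      then show "\<exists>I. initial r K k I \<and> card I = card F \<and> card (shadow I) \<le> card (shadow F)"
        using G(1) by (auto simp: P_def)
    qed
  qed
qed

subsection \<open>Cliques\<close>

definition cliques :: "('a \<Rightarrow> 'a \<Rightarrow> bool) \<Rightarrow> 'a set \<Rightarrow> nat \<Rightarrow> 'a set set" where
  "cliques E V k = {X. finite X \<and> X \<subseteq> V \<and> card X = k \<and> (\<forall>x\<in>X. \<forall>y\<in>X. x \<noteq> y \<longrightarrow> E x y)}"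

definition neighbours :: "('a \<Rightarrow> 'a \<Rightarrow> bool) \<Rightarrow> 'a set \<Rightarrow> 'a \<Rightarrow> 'a set" where
  "neighbours E V w = {u \<in> V. u \<noteq> w \<and> E w u}"

lemma finite_cliques: "finite V \<Longrightarrow> finite (cliques E V k)"
  by (rule finite_subset[of _ "Pow V"]) (auto simp: cliques_def)

lemma cliques_mono: "U \<subseteq> V \<Longrightarrow> cliques E U k \<subseteq> cliques E V k"
  by (auto simp: cliques_def)

lemma cliques_0: "cliques E V 0 = {{}}"
  by (auto simp: cliques_def)

lemma insert_clique:
  assumes "symp E" "w \<in> V" "X \<in> cliques E (neighbours E V w) k"
  shows "insert w X \<in> cliques E V (Suc k)"
proof -
  have "w \<notin> X" using assms(3) by (auto simp: cliques_def neighbours_def)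
  then show ?thesis
    using assms by (auto simp: cliques_def neighbours_def dest: sympD)
qed

lemma card_cliques_insert:
  assumes "finite U" "w \<notin> U" "symp E"
  shows "card (cliques E (insert w U) (Suc k)) =
    card (cliques E U (Suc k)) + card (cliques E (neighbours E U w) k)"
proof -
  have "cliques E (insert w U) (Suc k) = cliques E U (Suc k) \<union> insert w ` cliques E (neighbours E U w) k"
  proof (intro set_eqI iffI)
    fix X assume X: "X \<in> cliques E (insert w U) (Suc k)"
    show "X \<in> cliques E U (Suc k) \<union> insert w ` cliques E (neighbours E U w) k"
    proof (cases "w \<in> X")
      case True
      then have "X - {w} \<in> cliques E (neighbours E U w) k" "X = insert w (X - {w})"
        using X by (auto simp: cliques_def neighbours_def)
      then show ?thesis by blast
    next
      case False
      with X show ?thesis by (auto simp: cliques_def)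
    qed
  next
    fix X assume "X \<in> cliques E U (Suc k) \<union> insert w ` cliques E (neighbours E U w) k"
    moreover have "cliques E (neighbours E U w) k \<subseteq> cliques E (neighbours E (insert w U) w) k"
      by (rule cliques_mono) (auto simp: neighbours_def)
    moreover have "cliques E U (Suc k) \<subseteq> cliques E (insert w U) (Suc k)"
      by (rule cliques_mono) auto
    ultimately show "X \<in> cliques E (insert w U) (Suc k)"
      using insert_clique[OF assms(3), of w "insert w U"] by blast
  qed
  moreover have "card (\<dots>) = card (cliques E U (Suc k)) + card (insert w ` cliques E (neighbours E U w) k)"
    using assms by (intro card_Un_disjoint) (auto simp: cliques_def neighbours_def intro: finite_cliques[unfolded cliques_def])
  moreover have "inj_on (insert w) (cliques E (neighbours E U w) k)"
    by (rule inj_onI) (auto simp: cliques_def neighbours_def insert_ident)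
  ultimately show ?thesis by (simp add: card_image)
qed

text \<open>The vertices of \<open>W\<close> are added to \<open>U\<close> one at a time;
  \<open>L i\<close> collects the neighbours of the \<open>i\<close>-th among the vertices already
  present. One choice of \<open>L\<close> serves all \<open>k\<close>, so it counts cliques of two
  consecutive sizes together.\<close>

lemma card_cliques_by_links:
  assumes "finite W" "finite U" "U \<inter> W = {}" "symp E"
  shows "\<exists>(n::nat) w L. (\<forall>i<n. w i \<in> W \<and> L i \<subseteq> neighbours E (U \<union> W) (w i)) \<and>
    (\<forall>k. card (cliques E (U \<union> W) (Suc k)) =
      card (cliques E U (Suc k)) + (\<Sum>i<n. card (cliques E (L i) k)))"
  using assms
proof (induction W)
  case empty
  show ?case by (intro exI[of _ 0]) auto
next
  case (insert x W)
  then have "U \<inter> W = {}" by auto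
  from insert.IH[OF \<open>finite U\<close> this \<open>symp E\<close>] obtain n :: nat and w L
    where IH: "\<And>i. i < n \<Longrightarrow> w i \<in> W \<and> L i \<subseteq> neighbours E (U \<union> W) (w i)"
    "\<And>k. card (cliques E (U \<union> W) (Suc k)) =
      card (cliques E U (Suc k)) + (\<Sum>i<n. card (cliques E (L i) k))"
    by (elim exE conjE) blast
  let ?w = "w(n := x)" and ?L = "L(n := neighbours E (U \<union> W) x)"
  have "?w i \<in> insert x W \<and> ?L i \<subseteq> neighbours E (U \<union> insert x W) (?w i)" if "i < Suc n" for i
    using IH(1)[of i] that by (cases "i = n") (auto simp: neighbours_def)
  moreover have "card (cliques E (U \<union> insert x W) (Suc k)) =
      card (cliques E U (Suc k)) + (\<Sum>i<Suc n. card (cliques E (?L i) k))" for k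
  proof -
    have "x \<notin> U \<union> W" using insert by auto
    then show ?thesis
      using card_cliques_insert[of "U \<union> W" x E k] insert.prems insert.hyps IH(2)[of k] by simp
  qed
  ultimately show ?case by blast
qed

text \<open>Induction on the number of colours. Each \<open>k\<close> is treated on its own, and the
  choice of \<open>v\<close> may depend on it; the bound for the preceding size is all that the
  segments need in order to nest later.\<close>

lemma clique_initial:
  assumes "K \<subseteq> {..<r}" "finite V" "symp E"
    and "\<And>k X. X \<in> cliques E V k \<Longrightarrow> k \<le> card K"
  shows "\<exists>I. initial r K k I \<and> card I = card (cliques E V k) \<and>
    (\<forall>j. k = Suc j \<longrightarrow> card (shadow I) \<le> card (cliques E V j))"
  using assms
proof (induction "card K" arbitrary: K V k)
  case (0 K V k)
  show ?case
  proof (cases k)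
    case 0
    then show ?thesis by (intro exI[of _ "{{}}"]) (simp add: initial_def rainbow_0 cliques_0)
  next
    case (Suc j)
    then have "cliques E V k = {}" using 0(5)[of _ k] \<open>0 = card K\<close> by auto
    then show ?thesis by (intro exI[of _ "{}"]) (auto simp: initial_def shadow_def)
  qed
next
  case (Suc d K V k)
  note K = \<open>K \<subseteq> {..<r}\<close> and V = \<open>finite V\<close>
  have finK: "finite K" using K finite_subset by blast
  then obtain c where c: "c \<in> K" using \<open>Suc d = card K\<close> by fastforce
  have "r > 0" and cr: "c < r" using K c by auto
  have K': "d = card (K - {c})" "K - {c} \<subseteq> {..<r}" using c finK K \<open>Suc d = card K\<close> by auto
  show ?case
  proof (cases "k = 0 \<or> V = {}")
    case True
    show ?thesis
    proof (cases "k = 0")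
      case True
      then show ?thesis by (intro exI[of _ "{{}}"]) (simp add: initial_def rainbow_0 cliques_0)
    next
      case False
      with True have "cliques E V k = {}" by (auto simp: cliques_def)
      then show ?thesis by (intro exI[of _ "{}"]) (auto simp: initial_def shadow_def)
    qed
  next
    case False
    then obtain j where k: "k = Suc j" and "V \<noteq> {}" by (cases k) auto
    \<comment> \<open>A clique among neighbours of \<open>w\<close> extends by \<open>w\<close>, so
      one colour fewer suffices in a link.\<close>
    have IH: "\<exists>I. initial r (K - {c}) m I \<and> card I = card (cliques E U m) \<and>
        (\<forall>j. m = Suc j \<longrightarrow> card (shadow I) \<le> card (cliques E U j))"
      if w: "w \<in> V" and U: "U \<subseteq> neighbours E V w" for w U m
    proof (rule Suc.hyps(1)[OF K'])
      show "finite U" using U V by (auto simp: neighbours_def intro: finite_subset)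
      fix l X assume "X \<in> cliques E U l"
      then have "insert w X \<in> cliques E V (Suc l)"
        using cliques_mono[OF U, of E l] w \<open>symp E\<close> by (intro insert_clique) auto
      then show "l \<le> card (K - {c})" using Suc.prems(4) K'(1) \<open>Suc d = card K\<close> by fastforce
    qed (rule \<open>symp E\<close>)
    let ?deg = "\<lambda>w. card (cliques E (neighbours E V w) j)"
    have "Max (?deg ` V) \<in> ?deg ` V" using V \<open>V \<noteq> {}\<close> by (intro Max_in) auto
    then obtain v where v: "v \<in> V" "?deg v = Max (?deg ` V)" by auto
    then have vmax: "?deg w \<le> ?deg v" if "w \<in> V" for w using that V by simp
    define U where "U = neighbours E V v"
    have U: "U \<subseteq> V" "finite U" using V by (auto simp: U_def neighbours_def)
    obtain n :: nat and w L where wL: "\<And>i. i < n \<Longrightarrow> w i \<in> V - U \<and> L i \<subseteq> neighbours E (U \<union> (V - U)) (w i)"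
      and count: "\<And>k. card (cliques E (U \<union> (V - U)) (Suc k)) =
        card (cliques E U (Suc k)) + (\<Sum>i<n. card (cliques E (L i) k))"
    proof -
      have "finite (V - U)" "U \<inter> (V - U) = {}" using V by auto
      from card_cliques_by_links[OF this(1) \<open>finite U\<close> this(2) \<open>symp E\<close>] that show thesis
        by (elim exE conjE) blast
    qed
    have UV: "U \<union> (V - U) = V" using U by auto
    obtain B where B: "initial r (K - {c}) (Suc j) B" "card B = card (cliques E U (Suc j))"
      "card (shadow B) \<le> card (cliques E U j)"
      using IH[of v U "Suc j"] v by (auto simp: U_def)
    obtain J where J: "initial r (K - {c}) j J" "card J = card (cliques E U j)"
      using IH[of v U j] v by (auto simp: U_def)
    have "\<forall>i<n. \<exists>I. initial r (K - {c}) j I \<and> card I = card (cliques E (L i) j) \<and>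
        (\<forall>m. j = Suc m \<longrightarrow> card (shadow I) \<le> card (cliques E (L i) m))"
      using IH wL UV by (metis DiffD1)
    then obtain I where I: "\<And>i. i < n \<Longrightarrow> initial r (K - {c}) j (I i)"
      "\<And>i. i < n \<Longrightarrow> card (I i) = card (cliques E (L i) j)"
      "\<And>i m. i < n \<Longrightarrow> j = Suc m \<Longrightarrow> card (shadow (I i)) \<le> card (cliques E (L i) m)"
      by metis
    \<comment> \<open>The \<open>i\<close>-th deleted vertex becomes the vertex of colour
      \<open>c\<close> on level \<open>i\<close>; \<open>div r\<close> recovers
      \<open>i\<close>.\<close>
    define x where "x i = c + i * r" for i
    have x: "x i mod r = c" "x i div r = i" for i using cr by (auto simp: x_def)
    have inj: "inj_on x A" for A by (rule inj_on_inverseI[of _ "\<lambda>m. m div r"]) (rule x)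
    define W where "W = x ` {..<n}"
    define F where "F = join W B (\<lambda>y. I (y div r))"
    have IW: "initial r (K - {c}) j (I (y div r))" if "y \<in> W" for y
      using that I(1) x by (auto simp: W_def)
    have W: "finite W" "y mod r = c" if "y \<in> W" for y using that x by (auto simp: W_def)
    have finW: "finite W" by (simp add: W_def)
    have sumW: "(\<Sum>y\<in>W. f (y div r)) = (\<Sum>i<n. f i)" for f :: "nat \<Rightarrow> nat"
      unfolding W_def by (simp add: sum.reindex[OF inj] x)
    have FR: "F \<subseteq> rainbow r K (Suc j)"
      unfolding F_def
      by (rule rainbow_join[OF initialD(2)[OF B(1)] c W(2) initialD(2)[OF IW]])
    have finF: "finite F"
      unfolding F_def join_def using finW initialD(1)[OF B(1)] initialD(1)[OF IW] by auto
    have disj: "S \<inter> W = {}" if "S \<in> rainbow r (K - {c}) m" for S m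
      using that W by (auto simp: rainbow_diff_colour)
    have "card F = card B + (\<Sum>y\<in>W. card (I (y div r)))"
      unfolding F_def
    proof (rule card_join)
      show "S \<inter> W = {}" if "S \<in> B" for S using that initialD(2)[OF B(1)] disj by blast
      show "S \<inter> W = {}" if "y \<in> W" "S \<in> I (y div r)" for y S
        using that initialD(2)[OF IW] disj by blast
    qed (use finW initialD(1)[OF B(1)] initialD(1)[OF IW] in auto)
    also have "\<dots> = card B + (\<Sum>i<n. card (I i))" using sumW[of "\<lambda>i. card (I i)"] by simp
    also have "\<dots> = card (cliques E V k)" using count[of j] B(2) I(2) UV k by simp
    finally have cardF: "card F = card (cliques E V k)" .
    have "card (shadow F) \<le> card J + (\<Sum>y\<in>W. card (shadow (I (y div r))))"
      unfolding F_def
    proof (rule card_shadow_join_initial[OF finW W(2) K B(1) IW J(1)])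
      show "card (shadow B) \<le> card J" using B J by simp
      fix y assume "y \<in> W"
      then obtain i where i: "i < n" "y div r = i" using x by (auto simp: W_def)
      \<comment> \<open>\<open>L i\<close> lies in the neighbourhood of \<open>w i\<close>, so the
        maximality of \<open>v\<close> bounds the size of \<open>I i\<close> by that of
        \<open>J\<close>.\<close>
      have "card (I i) \<le> ?deg (w i)"
        using I(2)[OF i(1)] wL[OF i(1)] UV V
        by (auto intro!: card_mono cliques_mono finite_cliques simp: neighbours_def)
      also have "\<dots> \<le> ?deg v" using vmax wL[OF i(1)] by auto
      finally show "card (I (y div r)) \<le> card J" using J i by (simp add: U_def)
    qed
    also have "\<dots> = card (cliques E U j) + (\<Sum>i<n. card (shadow (I i)))"
      using J sumW[of "\<lambda>i. card (shadow (I i))"] by simp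
    \<comment> \<open>For \<open>j = 0\<close> the links contribute no shadow and both clique counts
      are 1, for the empty clique. Otherwise the same sets \<open>L i\<close> count the cliques one
      size lower.\<close>
    also have "\<dots> \<le> card (cliques E V j)"
    proof (cases j)
      case 0
      then have "shadow (I i) = {}" if "i < n" for i
        using initialD(2)[OF I(1)[OF that]] by (auto simp: rainbow_0 shadow_def)
      then show ?thesis using 0 by (simp add: cliques_0)
    next
      case (Suc m)
      then have "(\<Sum>i<n. card (shadow (I i))) \<le> (\<Sum>i<n. card (cliques E (L i) m))"
        using I(3) by (intro sum_mono) auto
      then show ?thesis using count[of m] UV Suc by simp
    qed
    finally have shadowF: "card (shadow F) \<le> card (cliques E V j)" .
    obtain G where "initial r K (Suc j) G" "card G = card F" "card (shadow G) \<le> card (shadow F)"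
      using coloured_kruskal_katona[OF K] finF FR unfolding initial_optimal_def by blast
    then show ?thesis using cardF shadowF k by auto
  qed
qed

subsection \<open>Flag complexes\<close>

text \<open>A clique that is not a face contains a smallest non-face, which is minimal and so has
  two elements; but all pairs in a clique are faces.\<close>

lemma flag_complex_faces:
  assumes "flag_complex V C"
  shows "{F \<in> C. card F = k} = cliques (\<lambda>x y. {x, y} \<in> C) V k"
proof (intro set_eqI iffI)
  have C: "finite V" "C \<subseteq> Pow V"
    using assms by (simp_all add: flag_complex_def simplicial_complex_def)
  have down: "A \<in> C" if "B \<in> C" "A \<subseteq> B" for A B
    using assms that unfolding flag_complex_def simplicial_complex_def by meson
  fix X
  {
    assume "X \<in> {F \<in> C. card F = k}"
    then have X: "X \<in> C" "card X = k" by auto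
    then have "X \<subseteq> V" "finite X" using C finite_subset by blast+
    moreover have "{x, y} \<in> C" if "x \<in> X" "y \<in> X" for x y
      using that X down[of X "{x, y}"] by auto
    ultimately show "X \<in> cliques (\<lambda>x y. {x, y} \<in> C) V k" using X by (auto simp: cliques_def)
  next
    assume X: "X \<in> cliques (\<lambda>x y. {x, y} \<in> C) V k"
    have "X \<in> C"
    proof (rule ccontr)
      assume "X \<notin> C"
      then obtain A where A: "A \<subseteq> X" "A \<notin> C" and least: "\<And>B. B \<subseteq> X \<Longrightarrow> B \<notin> C \<Longrightarrow> card A \<le> card B"
        using ex_has_least_nat[of "\<lambda>A. A \<subseteq> X \<and> A \<notin> C" X card] by blast
      have fin: "finite A" using A X finite_subset by (auto simp: cliques_def)
      have "B \<in> C" if "B \<subset> A" for B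
        using psubset_card_mono[OF fin that] least[of B] that A by fastforce
      then have "minimal_nonface V C A" using A X by (auto simp: minimal_nonface_def cliques_def)
      then have "card A = 2" using assms by (simp add: flag_complex_def)
      then obtain a b where "A = {a, b}" "a \<noteq> b" by (auto simp: card_2_iff)
      then show False using A X by (auto simp: cliques_def)
    qed
    with X show "X \<in> {F \<in> C. card F = k}" by (simp add: cliques_def)
  }
qed

theorem theorem1:
  fixes V :: "'a set" and C :: "'a set set"
  assumes "flag_complex V C"
  shows "\<exists>(V' :: nat set) (C' :: nat set set).
           balanced_complex V' C' \<and> face_vector C' = face_vector C"
proof -
  have C: "finite V" "C \<subseteq> Pow V" "{} \<in> C"
    using assms by (simp_all add: flag_complex_def simplicial_complex_def)
  have finC: "finite C" "\<And>F. F \<in> C \<Longrightarrow> finite F" using C finite_subset by blast+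
  define d where "d = Max (card ` C)"
  have "d \<in> card ` C" unfolding d_def using finC C by (intro Max_in) auto
  have le_d: "card F \<le> d" if "F \<in> C" for F unfolding d_def using finC that by auto
  \<comment> \<open>\<open>d\<close> colours suffice; the successor avoids the modulus \<open>0\<close>.\<close>
  define r where "r = Suc d"
  define K where "K = {..<d}"
  have K: "K \<subseteq> {..<r}" "card K = d" by (auto simp: K_def r_def)
  note faces = flag_complex_faces[OF assms]
  have "\<exists>I. initial r K k I \<and> card I = face_count C k \<and>
      (\<forall>j. k = Suc j \<longrightarrow> card (shadow I) \<le> face_count C j)" for k
    unfolding face_count_def faces
  proof (rule clique_initial[OF K(1) C(1)])
    show "symp (\<lambda>x y. {x, y} \<in> C)" by (auto simp: symp_def insert_commute)
    show "k \<le> card K" if "X \<in> cliques (\<lambda>x y. {x, y} \<in> C) V k" for k X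
      using that le_d[of X] K(2) unfolding faces[symmetric] by auto
  qed
  then obtain I where I: "\<And>k. initial r K k (I k)" "\<And>k. card (I k) = face_count C k"
    "\<And>j. card (shadow (I (Suc j))) \<le> face_count C j"
    by metis
  have IR: "F \<in> rainbow r K k" if "F \<in> I k" for F k using that initialD(2)[OF I(1)] by blast
  \<comment> \<open>Both families are initial segments, so the inequality between their sizes is
    enough. This closes the union of the levels under removing a vertex.\<close>
  have shadow_I: "shadow (I (Suc k)) \<subseteq> I k" for k
    using I by (intro initial_subset[OF initial_shadow[OF K(1) I(1)] I(1)]) simp
  define C' where "C' = (\<Union>k. I k)"
  define V' where "V' = \<Union>C'"
  have level: "{F \<in> C'. card F = k} = I k" for k
    using rainbowD(2)[OF IR] by (auto simp: C'_def)
  have count: "face_count C' = face_count C"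
    by (rule ext) (simp add: face_count_def level I(2)[unfolded face_count_def])
  have I_empty: "I k = {}" if "d < k" for k
  proof -
    have "{F \<in> C. card F = k} = {}" using le_d that by fastforce
    then have "card (I k) = 0" unfolding I(2) face_count_def by (simp only: card.empty)
    then show ?thesis using initialD(1)[OF I(1)[of k]] by simp
  qed
  have le_d': "card F \<le> d" if "F \<in> C'" for F
    using that I_empty rainbowD(2)[OF IR] by (force simp: C'_def not_less[symmetric])
  have "I d \<noteq> {}"
  proof -
    have "{F \<in> C. card F = d} \<noteq> {}" using \<open>d \<in> card ` C\<close> by auto
    then show ?thesis using I(2)[of d] finC by (auto simp: face_count_def card_eq_0_iff)
  qed
  then obtain F where F: "F \<in> I d" by auto
  then have FR: "F \<in> rainbow r K d" by (rule IR)
  have "C' = (\<Union>k\<le>d. I k)" unfolding C'_def using I_empty by (auto simp: not_le[symmetric])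
  then have finC': "finite C'" using initialD(1)[OF I(1)] by simp
  have finF: "finite G" if "G \<in> C'" for G using that rainbowD(1)[OF IR] by (auto simp: C'_def)
  have down: "A \<in> C'" if "B \<in> C'" "A \<subseteq> B" for A B
  proof -
    have "A \<in> C'" if "B \<in> I k" "A \<subseteq> B" for k
      using that
    proof (induction k arbitrary: B)
      case 0
      then show ?case using IR[OF 0(1)] by (auto simp: rainbow_0 C'_def)
    next
      case (Suc k)
      show ?case
      proof (cases "A = B")
        case True
        then show ?thesis using Suc.prems by (auto simp: C'_def)
      next
        case False
        then obtain b where "b \<in> B" "A \<subseteq> B - {b}" using Suc.prems by blast
        then show ?thesis using shadow_I[of k] shadowI[OF Suc.prems(1)] by (intro Suc.IH) auto
      qed
    qed
    then show ?thesis using that by (auto simp: C'_def)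
  qed
  have "simplicial_complex V' C'"
    unfolding simplicial_complex_def
  proof (intro conjI ballI allI impI)
    show "finite V'" using finC' finF by (auto simp: V'_def)
    show "{} \<in> C'" using F down[of F "{}"] by (auto simp: C'_def)
    show "{v} \<in> C'" if "v \<in> V'" for v using that by (auto simp: V'_def intro: down)
  qed (auto simp: V'_def intro: down)
  have dim: "complex_dim D = int d - 1"
    if D: "finite D" "\<And>F. F \<in> D \<Longrightarrow> card F \<le> d" "F \<in> D" "card F = d" for D :: "'b set set" and F
    unfolding complex_dim_def
  proof (rule Max_eqI)
    show "int d - 1 \<in> face_dim ` D" using D by (auto simp: face_dim_def intro!: image_eqI[of _ _ F])
    show "y \<le> int d - 1" if "y \<in> face_dim ` D" for y
      using that by (auto simp: face_dim_def dest: D(2))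
  qed (use D(1) in simp)
  obtain F0 where "F0 \<in> C" "card F0 = d" using \<open>d \<in> card ` C\<close> by auto
  then have dimC: "complex_dim C = int d - 1" using finC le_d by (intro dim)
  have "F \<in> C'" using F by (auto simp: C'_def)
  then have dimC': "complex_dim C' = int d - 1" using finC' le_d' rainbowD(2)[OF FR] by (intro dim)
  \<comment> \<open>The residue modulo \<open>r\<close> is a proper colouring with values in
    \<open>K = {..<d}\<close>; conversely the \<open>d\<close> vertices of the face \<open>F\<close>
    are pairwise adjacent.\<close>
  have "chromatic_number V' C' = d"
    unfolding chromatic_number_def graph_chromatic_number_def
  proof (rule Least_equality)
    have "(\<lambda>n. n mod r) ` V' \<subseteq> {..<d}"
      using rainbowD(4)[OF IR] by (auto simp: V'_def C'_def K_def)
    moreover have "u mod r \<noteq> v mod r" if uv: "{u, v} \<in> skeleton_edges C'" for u v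
    proof
      assume eq: "u mod r = v mod r"
      obtain k where "{u, v} \<in> rainbow r K k"
        using uv IR by (auto simp: skeleton_edges_def C'_def)
      then have "u = v" using eq rainbowD(5) by blast
      with uv show False by (simp add: skeleton_edges_def)
    qed
    ultimately show "\<exists>f. graph_colouring V' (skeleton_edges C') d f"
      unfolding graph_colouring_def by blast
  next
    fix k assume "\<exists>f. graph_colouring V' (skeleton_edges C') k f"
    then obtain f where f: "f ` V' \<subseteq> {..<k}" "\<And>u v. {u, v} \<in> skeleton_edges C' \<Longrightarrow> f u \<noteq> f v"
      unfolding graph_colouring_def by blast
    have "inj_on f F"
    proof (rule inj_onI, rule ccontr)
      fix u v assume uv: "u \<in> F" "v \<in> F" "f u = f v" "u \<noteq> v"
      then have "{u, v} \<in> skeleton_edges C'"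
        using down[OF \<open>F \<in> C'\<close>, of "{u, v}"] by (auto simp: skeleton_edges_def)
      with f(2) uv show False by blast
    qed
    moreover have "f ` F \<subseteq> {..<k}" using f(1) \<open>F \<in> C'\<close> by (auto simp: V'_def)
    ultimately show "d \<le> k" using card_inj_on_le[of f F "{..<k}"] rainbowD(2)[OF FR] by simp
  qed
  then have "balanced_complex V' C'"
    unfolding balanced_complex_def using \<open>simplicial_complex V' C'\<close> dimC' by simp
  moreover have "face_vector C' = face_vector C"
    unfolding face_vector_def count dimC dimC' ..
  ultimately show ?thesis by blast
qed

end
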